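(* Let $\pi^X\propto\exp(-f)$ be a target distribution on $\mathbb{R}^d$ and $\eta>0$. Let $\rho_k^X,\rho_k^Y,\rho_{k+1}^X$ be the distributions of $x_k,y_k,x_{k+1}$, respectively, in one iteration of the proximal sampler with target $\pi^X$ and step size $\eta$. Then they follow the entropy-regularized JKO scheme $$\rho_k^Y=\operatorname*{argmin}_{\mu\in\mathcal P_2(\mathbb{R}^d)}\frac1{2\eta}\,W_{2,2\eta}^2(\rho_k^X,\mu)$$ and $$\rho_{k+1}^X=\operatorname*{argmin}_{\mu\in\mathcal P_2(\mathbb{R}^d)}\Bigl\{\int f\,d\mu+\frac1{2\eta}\,W_{2,2\eta}^2(\rho_k^Y,\mu)\Bigr\}.$$
   Context: Probability measures are identified with their Lebesgue densities when these exist. $\mathcal P_2(\mathbb{R}^d)$ denotes the probability measures on $\mathbb{R}^d$ with finite second moment. The target $\pi^X\propto\exp(-f)$, $f:\mathbb{R}^d\to\mathbb{R}$, has finite second moment. Proximal sampler with step size $\eta$: given $x_k$, draw $y_k\mid x_k\sim\mathcal N(x_k,\eta I)$; given $y_k$, draw $x_{k+1}\mid y_k\sim\pi^{X\mid Y}(\cdot\mid y_k)$, where $\pi^{X\mid Y}(x\mid y)\propto_x\exp(-f(x)-\frac1{2\eta}\|x-y\|^2)$. Entropy-regularized 2-Wasserstein distance, for $\epsilon>0$: $$W_{2,\epsilon}^2(\mu,\nu):=\min_{\gamma\in\mathcal C(\mu,\nu)}\Bigl\{\int\|x-y\|^2\,d\gamma(x,y)+\epsilon H(\gamma)\Bigr\},$$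 where $\mathcal C(\mu,\nu)$ is the set of couplings of $\mu$ and $\nu$ (joint distributions on $\mathbb{R}^d\times\mathbb{R}^d$ with marginals $\mu$ and $\nu$), and $H(\gamma)=\int\gamma\log\gamma$ is the negative entropy. Thus $W_{2,2\eta}$ is $W_{2,\epsilon}$ with $\epsilon=2\eta$.
   Formalization: Assumes f Borel and ρ_k^X in P_2. The first argmin contains ρ_k^Y always, and is unique if H(ρ_k^X)<∞ (else the objective is +∞ everywhere); the second identity assumes the negative part of f is ρ_{k+1}^X-integrable (else the objective there is −∞+∞). *)

theory Defs
  imports "HOL-Probability.Probability"
begin

(* Integral with values in the extended reals. In type ereal, \<infinity> - \<infinity> = \<infinity>, so the value is
   \<infinity> in the one case where the integral does not exist. *)
definition ereal_integral :: "'b measure \<Rightarrow> ('b \<Rightarrow> real) \<Rightarrow> ereal" where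
  "ereal_integral M g =
     enn2ereal (\<integral>\<^sup>+ x. ennreal (g x) \<partial>M) - enn2ereal (\<integral>\<^sup>+ x. ennreal (- g x) \<partial>M)"

definition P2 :: "'a::euclidean_space measure set" where
  "P2 = {\<mu>. prob_space \<mu> \<and> sets \<mu> = sets borel \<and> (\<integral>\<^sup>+ x. ennreal ((norm x)\<^sup>2) \<partial>\<mu>) < \<infinity>}"

(* The probability measure with Lebesgue density proportional to exp (- f). *)
definition gibbs :: "('a::euclidean_space \<Rightarrow> real) \<Rightarrow> 'a measure" where
  "gibbs f = density lborel (\<lambda>x. ennreal (exp (- f x) / (\<integral>z. exp (- f z) \<partial>lborel)))"

(* The normal distribution with mean x and covariance \<eta> I. *)
definition gaussian :: "real \<Rightarrow> 'a::euclidean_space \<Rightarrow> 'a measure" where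
  "gaussian \<eta> x = density lborel
     (\<lambda>y. ennreal ((2 * pi * \<eta>) powr (- real DIM('a) / 2) * exp (- (norm (y - x))\<^sup>2 / (2 * \<eta>))))"

(* The conditional distribution of X given Y = y. *)
definition backward_kernel :: "('a::euclidean_space \<Rightarrow> real) \<Rightarrow> real \<Rightarrow> 'a \<Rightarrow> 'a measure" where
  "backward_kernel f \<eta> y = gibbs (\<lambda>x. f x + (norm (x - y))\<^sup>2 / (2 * \<eta>))"

definition couplings ::
  "'a::euclidean_space measure \<Rightarrow> 'a measure \<Rightarrow> ('a \<times> 'a) measure set" where
  "couplings \<mu> \<nu> = {\<gamma>. prob_space \<gamma> \<and> sets \<gamma> = sets borel \<and>
     distr \<gamma> borel fst = \<mu> \<and> distr \<gamma> borel snd = \<nu>}"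

(* \<integral> p log p for the Lebesgue density p, and \<infinity> if there is no density. Note 0 * ln 0 = 0. *)
definition neg_entropy :: "'a::euclidean_space measure \<Rightarrow> ereal" where
  "neg_entropy \<gamma> =
     (if absolutely_continuous lborel \<gamma>
      then ereal_integral lborel
             (\<lambda>z. enn2real (RN_deriv lborel \<gamma> z) * ln (enn2real (RN_deriv lborel \<gamma> z)))
      else \<infinity>)"

(* This is the squared distance itself; because of the entropy term it may be negative. *)
definition entropic_W2_sq ::
  "real \<Rightarrow> 'a::euclidean_space measure \<Rightarrow> 'a measure \<Rightarrow> ereal" where
  "entropic_W2_sq \<epsilon> \<mu> \<nu> =
     (INF \<gamma> \<in> couplings \<mu> \<nu>.
        enn2ereal (\<integral>\<^sup>+ z. ennreal ((norm (fst z - snd z))\<^sup>2) \<partial>\<gamma>) + ereal \<epsilon> * neg_entropy \<gamma>)"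

definition argmin_on :: "'b set \<Rightarrow> ('b \<Rightarrow> ereal) \<Rightarrow> 'b set" where
  "argmin_on S F = {\<mu>. is_arg_min F (\<lambda>\<nu>. \<nu> \<in> S) \<mu>}"

end

theory Submission
  imports Defs
begin

text \<open>
  Both steps are instances of one computation. Let \<open>\<rho>\<close> have Lebesgue density \<open>r\<close>, let
  \<open>k y x = exp (- f x - |x - y|\<^sup>2 / (2\<eta>)) / Z y\<close> be the density of the backward kernel with
  normalising constant \<open>Z y\<close>, and let \<open>\<rho>'\<close> be \<open>\<rho>\<close> pushed through this kernel. For a coupling
  \<open>\<gamma>\<close> of \<open>\<rho>\<close> and \<open>\<mu>\<close> with density \<open>p\<close>, the objective contributed by \<open>\<gamma>\<close> is
  \<open>\<integral> (f x + |x - y|\<^sup>2 / (2\<eta>) + ln p) d\<gamma> = \<integral> (ln r - ln Z) d\<rho> + KL(\<gamma> | r \<otimes> k)\<close>.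
  The first term on the right does not depend on \<open>\<gamma>\<close> or \<open>\<mu>\<close>, and the relative entropy
  vanishes at the joint law \<open>r \<otimes> k\<close>, whose second marginal is \<open>\<rho>'\<close>. So \<open>\<rho>'\<close> is a minimiser.

  Uniqueness compares infima over couplings, which might fail to be attained, so it needs a gap that is
  uniform in \<open>\<gamma>\<close>. The variational bound \<open>KL(\<gamma> | Q) \<ge> \<integral> \<phi> d\<gamma> + 1 - \<integral> exp \<phi> dQ\<close>, with
  \<open>\<phi> = t\<close> on \<open>{(y, x). x \<in> B}\<close> and \<open>0\<close> elsewhere, gives one that depends on \<open>\<mu>\<close> only:
  if \<open>\<mu> B - \<rho>' B = \<delta> > 0\<close>, then \<open>t = \<delta> / 2\<close> yields a gap of at least \<open>\<delta>\<^sup>2 / 4\<close>.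
  These two halves are \<open>free_energy_lower_bound\<close> and \<open>free_energy_joint\<close>; together they give
  \<open>proximal_step_argmin\<close>.

  The integrals of \<open>f\<close> and of \<open>ln p\<close> may be infinite or undefined, and they are added as
  extended reals in which \<open>\<infinity>\<close> absorbs \<open>-\<infinity>\<close>. Since their sum has an integrable lower bound,
  no term can be \<open>-\<infinity>\<close> unless another one is \<open>\<infinity>\<close>; this is \<open>integral_le_ereal_integral_sum\<close>,
  and it lets the computation above go through without case distinctions on \<open>f\<close>.
  Negative parts of entropies are controlled by second moments.

  The forward step is the case \<open>f = 0\<close>, where \<open>Z\<close> is constant and the kernel is Gaussian. If
  \<open>\<rho>X\<close> has infinite entropy, so has every coupling with some \<open>\<mu>\<close> in \<open>P2\<close>
  (\<open>neg_entropy_fst_finite\<close>), and every such \<open>\<mu>\<close> is a minimiser.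

  In the backward step \<open>\<rho>Y\<close> has a bounded density, hence finite entropy; with \<open>\<pi>\<close> the target and \<open>u = |x - y|\<^sup>2 / (2\<eta>)\<close>, the inequality of Jensen
  \<open>E\<^sub>\<pi> exp (- u) \<ge> exp (- E\<^sub>\<pi> u)\<close> bounds \<open>ln Z\<close> by a quadratic, and the inequality of Chebyshev
  \<open>E\<^sub>\<pi> (u exp (- u)) \<le> E\<^sub>\<pi> u * E\<^sub>\<pi> exp (- u)\<close> bounds the second moment of the kernel.
\<close>

section \<open>Integrals in the extended reals\<close>

lemma ereal_integral_less_top_iff:
  "ereal_integral M g < \<infinity> \<longleftrightarrow> (\<integral>\<^sup>+ x. ennreal (g x) \<partial>M) < \<infinity>"
  unfolding ereal_integral_def
  by (cases "\<integral>\<^sup>+ x. ennreal (g x) \<partial>M"; cases "\<integral>\<^sup>+ x. ennreal (- g x) \<partial>M")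
     (auto simp: enn2ereal_ennreal)

lemma ereal_integral_eq_integral:
  assumes "integrable M g"
  shows "ereal_integral M g = ereal (\<integral>x. g x \<partial>M)"
proof -
  have fin: "(\<integral>\<^sup>+ x. ennreal (g x) \<partial>M) \<noteq> \<infinity>" "(\<integral>\<^sup>+ x. ennreal (- g x) \<partial>M) \<noteq> \<infinity>"
    using assms by (auto simp: real_integrable_def)
  then show ?thesis
    unfolding ereal_integral_def real_lebesgue_integral_def[OF assms]
    by (cases "\<integral>\<^sup>+ x. ennreal (g x) \<partial>M"; cases "\<integral>\<^sup>+ x. ennreal (- g x) \<partial>M")
       (auto simp: enn2ereal_ennreal)
qed

lemma ereal_integral_nonneg:
  assumes "\<And>x. 0 \<le> g x"
  shows "ereal_integral M g = enn2ereal (\<integral>\<^sup>+ x. ennreal (g x) \<partial>M)"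
  using assms by (simp add: ereal_integral_def ennreal_neg zero_ennreal.rep_eq)

lemma ereal_integral_cong_AE:
  assumes "AE x in M. g x = h x"
  shows "ereal_integral M g = ereal_integral M h"
proof -
  have "(\<integral>\<^sup>+ x. ennreal (g x) \<partial>M) = (\<integral>\<^sup>+ x. ennreal (h x) \<partial>M)"
    "(\<integral>\<^sup>+ x. ennreal (- g x) \<partial>M) = (\<integral>\<^sup>+ x. ennreal (- h x) \<partial>M)"
    using assms by (auto intro!: nn_integral_cong_AE)
  then show ?thesis by (simp add: ereal_integral_def)
qed

lemma ereal_integral_distr:
  assumes [measurable]: "T \<in> measurable M N" "g \<in> borel_measurable N"
  shows "ereal_integral (distr M N T) g = ereal_integral M (\<lambda>x. g (T x))"
  by (simp add: ereal_integral_def nn_integral_distr)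

lemma integrable_of_ge:
  fixes g h :: "'b \<Rightarrow> real"
  assumes [measurable]: "g \<in> borel_measurable M"
    and g: "(\<integral>\<^sup>+ x. ennreal (g x) \<partial>M) < \<infinity>"
    and h: "integrable M h" and le: "AE x in M. h x \<le> g x"
  shows "integrable M g"
proof -
  have "(\<integral>\<^sup>+ x. ennreal (- g x) \<partial>M) \<le> (\<integral>\<^sup>+ x. ennreal (- h x) \<partial>M)"
    using le by (intro nn_integral_mono_AE) (auto intro!: ennreal_leI elim!: eventually_mono)
  also have "\<dots> < \<infinity>"
    using h by (auto simp: real_integrable_def less_top)
  finally show ?thesis
    using g by (auto simp: real_integrable_def)
qed

lemma nn_integral_pos_part_less_top:
  fixes g h :: "'b \<Rightarrow> real"
  assumes "integrable M h" "AE x in M. g x \<le> h x"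
  shows "(\<integral>\<^sup>+ x. ennreal (g x) \<partial>M) < \<infinity>"
proof -
  have "(\<integral>\<^sup>+ x. ennreal (g x) \<partial>M) \<le> (\<integral>\<^sup>+ x. ennreal (h x) \<partial>M)"
    using assms(2) by (intro nn_integral_mono_AE) (auto intro: ennreal_leI)
  also have "\<dots> < \<infinity>"
    using assms(1) by (auto simp: real_integrable_def less_top)
  finally show ?thesis .
qed

lemma integrable_pos_part:
  fixes g :: "'b \<Rightarrow> real"
  assumes [measurable]: "g \<in> borel_measurable M"
    and g: "(\<integral>\<^sup>+ x. ennreal (g x) \<partial>M) < \<infinity>"
  shows "integrable M (\<lambda>x. max 0 (g x))"
proof (rule integrableI_nonneg)
  have "(\<integral>\<^sup>+ x. ennreal (max 0 (g x)) \<partial>M) = (\<integral>\<^sup>+ x. ennreal (g x) \<partial>M)"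
    by (intro nn_integral_cong) (auto simp: max_def ennreal_neg)
  then show "(\<integral>\<^sup>+ x. ennreal (max 0 (g x)) \<partial>M) < \<infinity>" using g by simp
qed auto

text \<open>If any of the three integrals is \<open>\<infinity>\<close>, so is the sum, because \<open>\<infinity>\<close> absorbs \<open>-\<infinity>\<close>. Otherwise
  all three positive parts are integrable, and then the lower bound \<open>h\<close> controls each negative part
  by the positive parts of the other two terms. This is what excludes a value \<open>-\<infinity>\<close> of the
  objective when \<open>f\<close> is not bounded below.\<close>
lemma integral_le_ereal_integral_sum:
  fixes h u v w :: "'b \<Rightarrow> real"
  assumes h: "integrable M h"
    and [measurable]: "u \<in> borel_measurable M" "v \<in> borel_measurable M" "w \<in> borel_measurable M"
    and le: "AE x in M. h x \<le> u x + v x + w x"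
  shows "ereal (\<integral>x. h x \<partial>M) \<le> ereal_integral M u + (ereal_integral M v + ereal_integral M w)"
proof (cases "ereal_integral M u < \<infinity> \<and> ereal_integral M v < \<infinity> \<and> ereal_integral M w < \<infinity>")
  case False
  then show ?thesis by auto
next
  case True
  then have fin: "(\<integral>\<^sup>+ x. ennreal (u x) \<partial>M) < \<infinity>" "(\<integral>\<^sup>+ x. ennreal (v x) \<partial>M) < \<infinity>"
    "(\<integral>\<^sup>+ x. ennreal (w x) \<partial>M) < \<infinity>"
    unfolding ereal_integral_less_top_iff by blast+
  have pu: "integrable M (\<lambda>x. max 0 (u x))" and pv: "integrable M (\<lambda>x. max 0 (v x))"
    and pw: "integrable M (\<lambda>x. max 0 (w x))"
    using fin by (auto intro!: integrable_pos_part)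
  have iu: "integrable M u"
  proof (rule integrable_of_ge)
    show "integrable M (\<lambda>x. h x - max 0 (v x) - max 0 (w x))" using h pv pw by auto
    show "AE x in M. h x - max 0 (v x) - max 0 (w x) \<le> u x" using le by eventually_elim auto
  qed (use fin in auto)
  have iv: "integrable M v"
  proof (rule integrable_of_ge)
    show "integrable M (\<lambda>x. h x - max 0 (u x) - max 0 (w x))" using h pu pw by auto
    show "AE x in M. h x - max 0 (u x) - max 0 (w x) \<le> v x" using le by eventually_elim auto
  qed (use fin in auto)
  have iw: "integrable M w"
  proof (rule integrable_of_ge)
    show "integrable M (\<lambda>x. h x - max 0 (u x) - max 0 (v x))" using h pu pv by auto
    show "AE x in M. h x - max 0 (u x) - max 0 (v x) \<le> w x" using le by eventually_elim auto
  qed (use fin in auto)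
  have "(\<integral>x. h x \<partial>M) \<le> (\<integral>x. u x + v x + w x \<partial>M)"
    using h iu iv iw le by (intro integral_mono_AE) auto
  then show ?thesis
    using iu iv iw by (simp add: ereal_integral_eq_integral)
qed

text \<open>Transfers a real lower bound, valid for each coupling, to the infimum over couplings. The case
  \<open>a = -\<infinity>\<close> is consistent: the hypothesis then forces every \<open>T i\<close> to be \<open>\<infinity>\<close>.\<close>
lemma le_add_INF:
  fixes a :: ereal and c b :: real
  assumes c: "0 < c" and le: "\<And>i. i \<in> I \<Longrightarrow> ereal b \<le> a + ereal c * T i"
  shows "ereal b \<le> a + ereal c * (INF i\<in>I. T i)"
proof (cases a)
  case PInf
  then show ?thesis by simp
next
  case MInf
  have "T i = \<infinity>" if "i \<in> I" for i
    using le[OF that] c MInf by (cases "T i") auto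
  then have "(INF i\<in>I. T i) = \<infinity>"
    by (simp add: top_ereal_def[symmetric] cong: INF_cong)
  then show ?thesis using c MInf by simp
next
  case (real r)
  have "ereal ((b - r) / c) \<le> (INF i\<in>I. T i)"
  proof (rule INF_greatest)
    fix i assume "i \<in> I"
    from le[OF this] c real show "ereal ((b - r) / c) \<le> T i"
      by (cases "T i") (auto simp: field_simps)
  qed
  then show ?thesis using c real
    by (cases "INF i\<in>I. T i") (auto simp: field_simps)
qed

text \<open>Only an inequality, since the part of \<open>q\<close> living on \<open>{p = 0}\<close> is not seen by the measure
  with density \<open>p\<close>.\<close>
lemma nn_integral_ratio_le:
  assumes [measurable]: "p \<in> borel_measurable M" "q \<in> borel_measurable M"
    and p: "\<And>x. 0 \<le> p x" and q: "\<And>x. 0 \<le> q x"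
  shows "(\<integral>\<^sup>+ x. ennreal (q x / p x) \<partial>density M (\<lambda>x. ennreal (p x))) \<le> (\<integral>\<^sup>+ x. ennreal (q x) \<partial>M)"
proof -
  have "(\<integral>\<^sup>+ x. ennreal (q x / p x) \<partial>density M (\<lambda>x. ennreal (p x)))
      = (\<integral>\<^sup>+ x. ennreal (p x) * ennreal (q x / p x) \<partial>M)"
    by (simp add: nn_integral_density)
  also have "\<dots> \<le> (\<integral>\<^sup>+ x. ennreal (q x) \<partial>M)"
    using p q by (intro nn_integral_mono) (auto simp: ennreal_mult'[symmetric] intro!: ennreal_leI)
  finally show ?thesis .
qed

lemma AE_density_pos:
  assumes [measurable]: "p \<in> borel_measurable M"
  shows "AE x in density M (\<lambda>x. ennreal (p x)). 0 < p x"
  by (subst AE_density) (auto simp: ennreal_eq_0_iff not_le)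

section \<open>Densities and entropy\<close>

text \<open>Writing the entropy as the integral of \<open>ln p\<close> against \<open>\<gamma>\<close> itself, instead of \<open>p ln p\<close> against
  Lebesgue measure, lets all terms of the objective be compared under one measure.\<close>
lemma neg_entropy_density:
  fixes p :: "'a::euclidean_space \<Rightarrow> real"
  assumes \<gamma>: "\<gamma> = density lborel (\<lambda>x. ennreal (p x))" and "prob_space \<gamma>"
    and [measurable]: "p \<in> borel_measurable borel" and p: "\<And>x. 0 \<le> p x"
  shows "neg_entropy \<gamma> = ereal_integral \<gamma> (\<lambda>x. ln (p x))"
proof -
  have ac: "absolutely_continuous lborel \<gamma>"
    unfolding \<gamma> by (intro absolutely_continuousI_density) auto
  have "AE x in lborel. ennreal (p x) = RN_deriv lborel \<gamma> x"
    by (rule sigma_finite_measure.RN_deriv_unique[OF sigma_finite_lborel]) (auto simp: \<gamma>)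
  then have "AE x in lborel. enn2real (RN_deriv lborel \<gamma> x) * ln (enn2real (RN_deriv lborel \<gamma> x)) = p x * ln (p x)"
    by eventually_elim (use p in \<open>auto dest: sym\<close>)
  then have "neg_entropy \<gamma> = ereal_integral lborel (\<lambda>x. p x * ln (p x))"
    using ac by (simp add: neg_entropy_def ereal_integral_cong_AE)
  also have "\<dots> = ereal_integral \<gamma> (\<lambda>x. ln (p x))"
    using p by (simp add: ereal_integral_def \<gamma> nn_integral_density ennreal_mult'[symmetric])
  finally show ?thesis .
qed

lemma absolutely_continuous_density:
  fixes \<gamma> :: "'a::euclidean_space measure"
  assumes "absolutely_continuous lborel \<gamma>" "sets \<gamma> = sets borel" "prob_space \<gamma>"
  obtains p where "p \<in> borel_measurable borel" "\<And>x. 0 \<le> p x" "\<gamma> = density lborel (\<lambda>x. ennreal (p x))"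
proof -
  interpret \<gamma>: prob_space \<gamma> by fact
  let ?D = "RN_deriv lborel \<gamma>"
  have fin: "AE x in lborel. ?D x \<noteq> \<infinity>"
    using assms by (intro sigma_finite_measure.RN_deriv_finite[OF sigma_finite_lborel]) (auto simp: \<gamma>.sigma_finite_measure)
  have "\<gamma> = density lborel ?D"
    using assms by (simp add: sigma_finite_measure.density_RN_deriv[OF sigma_finite_lborel])
  also have "\<dots> = density lborel (\<lambda>x. ennreal (enn2real (?D x)))"
    using fin by (intro density_cong) (auto simp: less_top)
  finally show ?thesis by (intro that[of "\<lambda>x. enn2real (?D x)"]) auto
qed

lemma neg_entropy_finite_density:
  fixes \<gamma> :: "'a::euclidean_space measure"
  assumes "neg_entropy \<gamma> < \<infinity>" "sets \<gamma> = sets borel" "prob_space \<gamma>"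
  obtains p where "p \<in> borel_measurable borel" "\<And>x. 0 \<le> p x" "\<gamma> = density lborel (\<lambda>x. ennreal (p x))"
  using assms absolutely_continuous_density
  by (metis neg_entropy_def less_irrefl)

lemma P2D:
  assumes "\<mu> \<in> P2"
  shows "prob_space \<mu>" "sets \<mu> = sets borel" "space \<mu> = UNIV" "(\<integral>\<^sup>+ x. ennreal ((norm x)\<^sup>2) \<partial>\<mu>) < \<infinity>"
    "integrable \<mu> (\<lambda>x. (norm x)\<^sup>2)"
proof -
  show "prob_space \<mu>" and s: "sets \<mu> = sets borel" and fin: "(\<integral>\<^sup>+ x. ennreal ((norm x)\<^sup>2) \<partial>\<mu>) < \<infinity>"
    using assms by (auto simp: P2_def)
  show "space \<mu> = UNIV" using sets_eq_imp_space_eq[OF s] by simp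
  have [measurable_cong]: "sets \<mu> = sets borel" by fact
  show "integrable \<mu> (\<lambda>x. (norm x)\<^sup>2)"
    using fin by (intro integrableI_nonneg) auto
qed

text \<open>The Gaussian integral: the integrand is a product over the coordinates.\<close>
lemma integrable_exp_neg_norm_sq:
  assumes "0 < c"
  shows "integrable lborel (\<lambda>x::'a::euclidean_space. exp (- (norm x)\<^sup>2 / (2 * c)))"
    and "(\<integral>x. exp (- (norm (x::'a))\<^sup>2 / (2 * c)) \<partial>lborel) = (2 * pi * c) powr (real DIM('a) / 2)"
proof -
  have 1: "has_bochner_integral lborel (\<lambda>t::real. exp (- t\<^sup>2 / (2 * c))) (sqrt (2 * pi * c))"
  proof -
    have "has_bochner_integral lborel (\<lambda>t. normal_density 0 (sqrt c) t) 1"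
      using assms integrable_normal_density[of "sqrt c" 0] integral_normal_density[of "sqrt c" 0]
      by (auto simp: has_bochner_integral_iff)
    from has_bochner_integral_mult_right[OF this, of "sqrt (2 * pi * c)"]
    show ?thesis using assms by (simp add: normal_density_def)
  qed
  have nn1: "(\<integral>\<^sup>+ t. ennreal (exp (- (t::real)\<^sup>2 / (2 * c))) \<partial>lborel) = ennreal (sqrt (2 * pi * c))"
    using 1 by (subst nn_integral_eq_integral) (auto simp: has_bochner_integral_iff)
  have "(norm x)\<^sup>2 = (\<Sum>b\<in>Basis. (x \<bullet> b)\<^sup>2)" for x :: 'a
    unfolding power2_norm_eq_inner by (subst euclidean_inner) (simp add: power2_eq_square)
  then have e: "ennreal (exp (- (norm x)\<^sup>2 / (2 * c))) = (\<Prod>b\<in>Basis. ennreal (exp (- (x \<bullet> b)\<^sup>2 / (2 * c))))" for x :: 'a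
    by (simp add: prod_ennreal exp_sum[symmetric] sum_negf sum_divide_distrib)
  have "(\<integral>\<^sup>+ x. ennreal (exp (- (norm (x::'a))\<^sup>2 / (2 * c))) \<partial>lborel) = (\<Prod>b\<in>(Basis::'a set). ennreal (sqrt (2 * pi * c)))"
    unfolding e by (subst nn_integral_lborel_prod) (simp_all add: nn1[simplified])
  also have "\<dots> = ennreal ((2 * pi * c) powr (real DIM('a) / 2))"
    using assms by (simp add: ennreal_power powr_half_sqrt_powr[symmetric] powr_powr powr_realpow[symmetric] powr_half_sqrt[symmetric])
  finally have nn: "(\<integral>\<^sup>+ x. ennreal (exp (- (norm (x::'a))\<^sup>2 / (2 * c))) \<partial>lborel) = ennreal ((2 * pi * c) powr (real DIM('a) / 2))" .
  show i: "integrable lborel (\<lambda>x::'a. exp (- (norm x)\<^sup>2 / (2 * c)))"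
    by (rule integrableI_nonneg) (use nn in auto)
  show "(\<integral>x. exp (- (norm (x::'a))\<^sup>2 / (2 * c)) \<partial>lborel) = (2 * pi * c) powr (real DIM('a) / 2)"
    by (subst integral_eq_nn_integral) (use nn in auto)
qed

text \<open>A finite second moment bounds the negative part of \<open>ln p\<close>: compare \<open>p\<close> with the Gaussian
  \<open>g = exp (- |x|\<^sup>2 / 2)\<close> through \<open>ln (g / p) \<le> g / p - 1\<close>, where the integral of \<open>g / p\<close>
  against \<open>\<mu>\<close> is at most that of \<open>g\<close> against Lebesgue measure.\<close>
lemma nn_integral_neg_ln_density_finite:
  fixes \<mu> :: "'a::euclidean_space measure"
  assumes "\<mu> \<in> P2" and \<mu>: "\<mu> = density lborel (\<lambda>x. ennreal (p x))"
    and [measurable]: "p \<in> borel_measurable borel" and p: "\<And>x. 0 \<le> p x"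
  shows "(\<integral>\<^sup>+ x. ennreal (- ln (p x)) \<partial>\<mu>) < \<infinity>"
proof -
  let ?g = "\<lambda>x::'a. exp (- (norm x)\<^sup>2 / (2 * 1))"
  have [measurable_cong]: "sets \<mu> = sets borel" using P2D[OF \<open>\<mu> \<in> P2\<close>] by simp
  have "AE x in \<mu>. - ln (p x) \<le> (norm x)\<^sup>2 + ?g x / p x"
    using AE_density_pos[of p lborel, folded \<mu>, simplified]
  proof eventually_elim
    case (elim x)
    have "- (norm x)\<^sup>2 / 2 - ln (p x) = ln (?g x / p x)"
      using elim by (simp add: ln_div)
    also have "\<dots> \<le> ?g x / p x - 1"
      using elim by (intro ln_le_minus_one) auto
    finally show ?case
      using zero_le_power2[of "norm x"] by linarith
  qed
  moreover have "integrable \<mu> (\<lambda>x. (norm x)\<^sup>2 + ?g x / p x)"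
  proof (intro Bochner_Integration.integrable_add P2D(5) integrableI_nonneg)
    have "(\<integral>\<^sup>+ x. ennreal (?g x / p x) \<partial>\<mu>) \<le> (\<integral>\<^sup>+ x. ennreal (?g x) \<partial>lborel)"
      unfolding \<mu> by (rule nn_integral_ratio_le) (use p in auto)
    also have "\<dots> < \<infinity>"
      using integrable_exp_neg_norm_sq(1)[of 1] by (auto simp: real_integrable_def less_top)
    finally show "(\<integral>\<^sup>+ x. ennreal (?g x / p x) \<partial>\<mu>) < \<infinity>" .
  qed (use p assms(1) in auto)
  ultimately show ?thesis by (rule nn_integral_pos_part_less_top[rotated])
qed

section \<open>Couplings\<close>
lemma couplingsD:
  assumes "\<gamma> \<in> couplings \<mu> \<nu>"
  shows "prob_space \<gamma>" "sets \<gamma> = sets borel" "distr \<gamma> borel fst = \<mu>" "distr \<gamma> borel snd = \<nu>"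
    "fst \<in> measurable \<gamma> borel" "snd \<in> measurable \<gamma> borel"
proof -
  show s: "prob_space \<gamma>" "sets \<gamma> = sets borel" "distr \<gamma> borel fst = \<mu>" "distr \<gamma> borel snd = \<nu>"
    using assms by (auto simp: couplings_def)
  show "fst \<in> measurable \<gamma> borel" "snd \<in> measurable \<gamma> borel"
    unfolding measurable_cong_sets[OF s(2) refl] borel_prod[symmetric] by measurable
qed

lemma integrable_coupling:
  fixes g :: "'a::euclidean_space \<Rightarrow> real"
  assumes "\<gamma> \<in> couplings \<mu> \<nu>" and [measurable]: "g \<in> borel_measurable borel"
  shows "integrable \<gamma> (\<lambda>z. g (fst z)) \<longleftrightarrow> integrable \<mu> g" "integrable \<gamma> (\<lambda>z. g (snd z)) \<longleftrightarrow> integrable \<nu> g"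
    "(\<integral>z. g (fst z) \<partial>\<gamma>) = (\<integral>y. g y \<partial>\<mu>)" "(\<integral>z. g (snd z) \<partial>\<gamma>) = (\<integral>x. g x \<partial>\<nu>)"
proof -
  note [measurable] = couplingsD(5,6)[OF assms(1)]
  note d = couplingsD(3,4)[OF assms(1), symmetric]
  show "integrable \<gamma> (\<lambda>z. g (fst z)) \<longleftrightarrow> integrable \<mu> g" by (simp add: d(1) integrable_distr_eq)
  show "integrable \<gamma> (\<lambda>z. g (snd z)) \<longleftrightarrow> integrable \<nu> g" by (simp add: d(2) integrable_distr_eq)
  show "(\<integral>z. g (fst z) \<partial>\<gamma>) = (\<integral>y. g y \<partial>\<mu>)" by (simp add: d(1) integral_distr)
  show "(\<integral>z. g (snd z) \<partial>\<gamma>) = (\<integral>x. g x \<partial>\<nu>)" by (simp add: d(2) integral_distr)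
qed

lemma norm_prod_sq: "(norm z)\<^sup>2 = (norm (fst z))\<^sup>2 + (norm (snd z))\<^sup>2"
  for z :: "'a::real_normed_vector \<times> 'b::real_normed_vector"
  by (cases z) (simp add: norm_Pair)

lemma norm_diff_sq_le: "(norm (x - y))\<^sup>2 \<le> 2 * (norm x)\<^sup>2 + 2 * (norm y)\<^sup>2" for x y :: "'a::real_inner"
proof -
  have "0 \<le> (norm (x + y))\<^sup>2" by simp
  then show ?thesis
    unfolding power2_norm_eq_inner by (simp add: inner_simps inner_commute)
qed

lemma coupling_in_P2:
  assumes "\<gamma> \<in> couplings \<mu> \<nu>" "\<mu> \<in> P2" "\<nu> \<in> P2"
  shows "\<gamma> \<in> P2"
proof -
  have "integrable \<gamma> (\<lambda>z. (norm (fst z))\<^sup>2 + (norm (snd z))\<^sup>2)"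
    using integrable_coupling(1,2)[OF assms(1), of "\<lambda>x. (norm x)\<^sup>2"] P2D(5)[OF assms(2)] P2D(5)[OF assms(3)]
    by simp
  then have "(\<integral>\<^sup>+ z. ennreal ((norm z)\<^sup>2) \<partial>\<gamma>) < \<infinity>"
    unfolding norm_prod_sq by (auto simp: real_integrable_def less_top)
  then show ?thesis using couplingsD[OF assms(1)] by (auto simp: P2_def)
qed

lemma integrable_transport_cost:
  assumes "\<gamma> \<in> couplings \<mu> \<nu>" "\<mu> \<in> P2" "\<nu> \<in> P2"
  shows "integrable \<gamma> (\<lambda>z. (norm (fst z - snd z))\<^sup>2)"
proof (rule Bochner_Integration.integrable_bound)
  show "integrable \<gamma> (\<lambda>z. 2 * (norm (fst z))\<^sup>2 + 2 * (norm (snd z))\<^sup>2)"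
    using integrable_coupling(1,2)[OF assms(1), of "\<lambda>x. (norm x)\<^sup>2"] P2D(5)[OF assms(2)] P2D(5)[OF assms(3)]
    by simp
  note [measurable] = couplingsD(5,6)[OF assms(1)]
  show "(\<lambda>z. (norm (fst z - snd z))\<^sup>2) \<in> borel_measurable \<gamma>" by measurable
qed (auto intro!: norm_diff_sq_le)

text \<open>The scaling \<open>\<epsilon> = 2\<eta>\<close> is the one for which dividing by \<open>2\<eta>\<close> leaves the entropy with
  coefficient one.\<close>
lemma entropic_cost_eq:
  fixes \<gamma> :: "('a::euclidean_space \<times> 'a) measure"
  assumes "0 < \<eta>" "sets \<gamma> = sets borel"
  shows "ereal (1 / (2 * \<eta>)) * (enn2ereal (\<integral>\<^sup>+ z. ennreal ((norm (fst z - snd z))\<^sup>2) \<partial>\<gamma>) + ereal (2 * \<eta>) * neg_entropy \<gamma>)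
    = ereal_integral \<gamma> (\<lambda>z. (norm (snd z - fst z))\<^sup>2 / (2 * \<eta>)) + neg_entropy \<gamma>"
proof -
  note [measurable_cong] = assms(2)
  have [measurable]: "fst \<in> measurable \<gamma> borel" "snd \<in> measurable \<gamma> borel"
    unfolding measurable_cong_sets[OF assms(2) refl] borel_prod[symmetric] by measurable
  have "ereal_integral \<gamma> (\<lambda>z. (norm (snd z - fst z))\<^sup>2 / (2 * \<eta>))
      = enn2ereal (\<integral>\<^sup>+ z. ennreal (1 / (2 * \<eta>)) * ennreal ((norm (fst z - snd z))\<^sup>2) \<partial>\<gamma>)"
    using assms(1) by (subst ereal_integral_nonneg) (auto simp: ennreal_mult'[symmetric] norm_minus_commute)
  also have "\<dots> = ereal (1 / (2 * \<eta>)) * enn2ereal (\<integral>\<^sup>+ z. ennreal ((norm (fst z - snd z))\<^sup>2) \<partial>\<gamma>)"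
    using assms(1) by (subst nn_integral_cmult) (auto simp: times_ennreal.rep_eq enn2ereal_ennreal)
  finally have c: "ereal_integral \<gamma> (\<lambda>z. (norm (snd z - fst z))\<^sup>2 / (2 * \<eta>)) = \<dots>" .
  have "ereal (1 / (2 * \<eta>)) * (ereal (2 * \<eta>) * neg_entropy \<gamma>) = neg_entropy \<gamma>"
    using assms(1) by (simp add: mult.assoc[symmetric] one_ereal_def[symmetric])
  moreover have "ereal (1 / (2 * \<eta>)) * (a + b) = ereal (1 / (2 * \<eta>)) * a + ereal (1 / (2 * \<eta>)) * b" for a b
    using assms(1) by (cases a; cases b) (auto simp: field_simps)
  ultimately show ?thesis unfolding c by simp
qed

section \<open>The backward kernel and its joint law\<close>

text \<open>Integrability of the weight is required in place of integrability of \<open>exp (- f)\<close>, so that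
  \<open>f = 0\<close>, for which the kernel is Gaussian, is an instance.\<close>
locale proximal_kernel =
  fixes f :: "'a::euclidean_space \<Rightarrow> real" and \<eta> :: real
  assumes eta: "0 < \<eta>"
    and f_measurable [measurable]: "f \<in> borel_measurable borel"
    and integrable_weight: "\<And>y. integrable lborel (\<lambda>x. exp (- (f x + (norm (x - y))\<^sup>2 / (2 * \<eta>))))"
begin

definition Z :: "'a \<Rightarrow> real" where
  "Z y = (\<integral>x. exp (- (f x + (norm (x - y))\<^sup>2 / (2 * \<eta>))) \<partial>lborel)"

definition k :: "'a \<Rightarrow> 'a \<Rightarrow> real" where
  "k y x = exp (- (f x + (norm (x - y))\<^sup>2 / (2 * \<eta>))) / Z y"

lemma measurable_Z [measurable]: "Z \<in> borel_measurable borel"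
  unfolding Z_def by measurable

lemma measurable_k [measurable]:
  assumes [measurable]: "g \<in> measurable M borel" "h \<in> measurable M borel"
  shows "(\<lambda>z. k (g z) (h z)) \<in> borel_measurable M"
  unfolding k_def by measurable

lemma Z_pos: "0 < Z y"
proof -
  let ?w = "\<lambda>x. exp (- (f x + (norm (x - y))\<^sup>2 / (2 * \<eta>)))"
  have "Z y \<noteq> 0"
  proof
    assume "Z y = 0"
    then have "AE x in lborel. ?w x = 0"
      using integral_nonneg_eq_0_iff_AE[OF integrable_weight] unfolding Z_def by auto
    then have "AE x::'a in lborel. False" by simp
    then have "emeasure lborel (UNIV :: 'a set) = 0" by (simp add: AE_iff_measurable[OF _ refl])
    then show False by simp
  qed
  moreover have "0 \<le> Z y" unfolding Z_def by (intro integral_nonneg_AE) auto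
  ultimately show ?thesis by simp
qed

lemma k_pos: "0 < k y x"
  using Z_pos by (simp add: k_def)

lemma ln_k: "ln (k y x) = - f x - (norm (x - y))\<^sup>2 / (2 * \<eta>) - ln (Z y)"
  using Z_pos[of y] by (simp add: k_def ln_div)

lemma backward_kernel_eq: "backward_kernel f \<eta> y = density lborel (\<lambda>x. ennreal (k y x))"
  by (simp add: backward_kernel_def gibbs_def k_def Z_def)

lemma nn_integral_backward_kernel:
  assumes "h \<in> borel_measurable borel"
  shows "(\<integral>\<^sup>+ x. h x \<partial>backward_kernel f \<eta> y) = (\<integral>\<^sup>+ x. ennreal (k y x) * h x \<partial>lborel)"
  unfolding backward_kernel_eq using assms by (subst nn_integral_density) auto

lemma nn_integral_k: "(\<integral>\<^sup>+ x. ennreal (k y x) \<partial>lborel) = 1"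
proof -
  have "integrable lborel (k y)" "(\<integral>x. k y x \<partial>lborel) = 1"
    unfolding k_def using integrable_weight[of y] Z_pos[of y] by (auto simp: Z_def)
  then show ?thesis
    using k_pos by (subst nn_integral_eq_integral) (auto intro: less_imp_le)
qed

lemma prob_space_backward_kernel: "prob_space (backward_kernel f \<eta> y)"
  by (rule prob_spaceI) (simp add: backward_kernel_eq emeasure_density nn_integral_k)

lemma sets_backward_kernel [simp]: "sets (backward_kernel f \<eta> y) = sets borel"
  by (simp add: backward_kernel_eq)

lemma measurable_backward_kernel: "backward_kernel f \<eta> \<in> measurable borel (subprob_algebra borel)"
proof (rule measurable_subprob_algebra)
  fix y show "subprob_space (backward_kernel f \<eta> y)"
    using prob_space_backward_kernel by (rule prob_space_imp_subprob_space)
next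
  fix A :: "'a set" assume [measurable]: "A \<in> sets borel"
  have "(\<lambda>y. \<integral>\<^sup>+ x. ennreal (k y x) * indicator A x \<partial>lborel) \<in> borel_measurable borel"
    by measurable
  then show "(\<lambda>y. emeasure (backward_kernel f \<eta> y) A) \<in> borel_measurable borel"
    by (simp add: backward_kernel_eq emeasure_density)
qed simp

lemma bind_backward_kernel:
  assumes "prob_space \<rho>" and s: "sets \<rho> = sets borel"
  shows "prob_space (\<rho> \<bind> backward_kernel f \<eta>)" "sets (\<rho> \<bind> backward_kernel f \<eta>) = sets borel"
    and "h \<in> borel_measurable borel \<Longrightarrow>
      (\<integral>\<^sup>+ x. h x \<partial>(\<rho> \<bind> backward_kernel f \<eta>)) = (\<integral>\<^sup>+ y. \<integral>\<^sup>+ x. ennreal (k y x) * h x \<partial>lborel \<partial>\<rho>)"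
proof -
  interpret prob_space \<rho> by fact
  have m: "backward_kernel f \<eta> \<in> measurable \<rho> (subprob_algebra borel)"
    using measurable_backward_kernel by (simp add: measurable_cong_sets[OF s refl])
  show "prob_space (\<rho> \<bind> backward_kernel f \<eta>)"
    by (rule prob_space_bind[OF _ m]) (simp add: prob_space_backward_kernel)
  show "sets (\<rho> \<bind> backward_kernel f \<eta>) = sets borel"
    by (rule sets_bind[OF _ not_empty]) simp
  show "(\<integral>\<^sup>+ x. h x \<partial>(\<rho> \<bind> backward_kernel f \<eta>)) = (\<integral>\<^sup>+ y. \<integral>\<^sup>+ x. ennreal (k y x) * h x \<partial>lborel \<partial>\<rho>)"
    if "h \<in> borel_measurable borel"
    using that by (subst nn_integral_bind[OF _ m]) (auto simp: nn_integral_backward_kernel)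
qed

text \<open>The density of the joint law of \<open>(y, x)\<close> when \<open>y\<close> has density \<open>r\<close> and \<open>x\<close> is drawn from the
  kernel at \<open>y\<close>; it is the optimal coupling.\<close>
definition joint :: "('a \<Rightarrow> real) \<Rightarrow> 'a \<times> 'a \<Rightarrow> real" where
  "joint r z = r (fst z) * k (fst z) (snd z)"

lemma measurable_joint [measurable]:
  assumes [measurable]: "r \<in> borel_measurable borel"
  shows "joint r \<in> borel_measurable borel"
proof -
  have [measurable]: "fst \<in> measurable (borel :: ('a \<times> 'a) measure) borel"
     "snd \<in> measurable (borel :: ('a \<times> 'a) measure) borel"
    unfolding borel_prod[symmetric] by measurable
  show ?thesis unfolding joint_def[abs_def] by measurable
qed

lemma nn_integral_joint:
  assumes [measurable]: "r \<in> borel_measurable borel" and r: "\<And>y. 0 \<le> r y"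
    and h [measurable]: "h \<in> borel_measurable borel"
  shows "(\<integral>\<^sup>+ z. h z \<partial>density lborel (\<lambda>z. ennreal (joint r z)))
    = (\<integral>\<^sup>+ y. \<integral>\<^sup>+ x. ennreal (k y x) * h (y, x) \<partial>lborel \<partial>density lborel (\<lambda>y. ennreal (r y)))"
proof -
  have [measurable]: "h \<in> borel_measurable (lborel \<Otimes>\<^sub>M lborel)" "joint r \<in> borel_measurable (lborel \<Otimes>\<^sub>M lborel)"
    unfolding lborel_prod using h by auto
  have "(\<integral>\<^sup>+ z. h z \<partial>density lborel (\<lambda>z. ennreal (joint r z))) = (\<integral>\<^sup>+ z. ennreal (joint r z) * h z \<partial>lborel)"
    by (simp add: nn_integral_density)
  also have "\<dots> = (\<integral>\<^sup>+ y. \<integral>\<^sup>+ x. ennreal (joint r (y, x)) * h (y, x) \<partial>lborel \<partial>lborel)"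
    unfolding lborel_prod[symmetric] by (subst lborel.nn_integral_fst[symmetric]) auto
  also have "\<dots> = (\<integral>\<^sup>+ y. ennreal (r y) * (\<integral>\<^sup>+ x. ennreal (k y x) * h (y, x) \<partial>lborel) \<partial>lborel)"
    using r k_pos by (intro nn_integral_cong, subst nn_integral_cmult[symmetric])
      (auto simp: joint_def ennreal_mult less_imp_le mult.assoc)
  also have "\<dots> = (\<integral>\<^sup>+ y. \<integral>\<^sup>+ x. ennreal (k y x) * h (y, x) \<partial>lborel \<partial>density lborel (\<lambda>y. ennreal (r y)))"
    by (subst nn_integral_density) auto
  finally show ?thesis .
qed

lemma joint_coupling:
  assumes \<rho>: "\<rho> = density lborel (\<lambda>y. ennreal (r y))" "prob_space \<rho>"
    and [measurable]: "r \<in> borel_measurable borel" and r: "\<And>y. 0 \<le> r y"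
  shows "density lborel (\<lambda>z. ennreal (joint r z)) \<in> couplings \<rho> (\<rho> \<bind> backward_kernel f \<eta>)"
proof -
  let ?G = "density lborel (\<lambda>z. ennreal (joint r z))"
  have s: "sets \<rho> = sets borel" by (simp add: \<rho>)
  have [measurable]: "fst \<in> measurable (borel :: ('a \<times> 'a) measure) borel"
     "snd \<in> measurable (borel :: ('a \<times> 'a) measure) borel"
    unfolding borel_prod[symmetric] by measurable
  note J = nn_integral_joint[of r, OF _ r, folded \<rho>(1)]
  interpret prob_space \<rho> by fact
  have "distr ?G borel fst = \<rho>"
  proof (rule measure_eqI)
    fix A assume "A \<in> sets (distr ?G borel fst)"
    then have [measurable]: "A \<in> sets borel" by simp
    have [measurable]: "A \<in> sets \<rho>" using s by simp
    have "emeasure (distr ?G borel fst) A = (\<integral>\<^sup>+ z. indicator A (fst z) \<partial>?G)"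
      by (subst nn_integral_distr[symmetric, of fst _ borel]) auto
    also have "\<dots> = (\<integral>\<^sup>+ y. indicator A y \<partial>\<rho>)"
      by (subst J) (auto simp: nn_integral_multc nn_integral_k)
    finally show "emeasure (distr ?G borel fst) A = emeasure \<rho> A" by simp
  qed (simp add: s)
  moreover have "distr ?G borel snd = \<rho> \<bind> backward_kernel f \<eta>"
  proof (rule measure_eqI)
    fix A assume "A \<in> sets (distr ?G borel snd)"
    then have [measurable]: "A \<in> sets borel" by simp
    have [simp]: "A \<in> sets (\<rho> \<bind> backward_kernel f \<eta>)" using bind_backward_kernel(2)[OF \<rho>(2) s] by simp
    have "emeasure (distr ?G borel snd) A = (\<integral>\<^sup>+ z. indicator A (snd z) \<partial>?G)"
      by (subst nn_integral_distr[symmetric, of snd _ borel]) auto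
    also have "\<dots> = (\<integral>\<^sup>+ y. \<integral>\<^sup>+ x. ennreal (k y x) * indicator A x \<partial>lborel \<partial>\<rho>)"
      by (subst J) auto
    also have "\<dots> = (\<integral>\<^sup>+ x. indicator A x \<partial>(\<rho> \<bind> backward_kernel f \<eta>))"
      by (subst bind_backward_kernel(3)[OF \<rho>(2) s]) auto
    finally show "emeasure (distr ?G borel snd) A = emeasure (\<rho> \<bind> backward_kernel f \<eta>) A" by simp
  qed (simp add: bind_backward_kernel(2)[OF \<rho>(2) s])
  moreover have "prob_space ?G"
  proof (rule prob_spaceI)
    have "emeasure ?G (space ?G) = (\<integral>\<^sup>+ z. 1 \<partial>?G)" by simp
    also have "\<dots> = 1" using emeasure_space_1 by (subst J) (auto simp: nn_integral_k)
    finally show "emeasure ?G (space ?G) = 1" .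
  qed
  ultimately show ?thesis by (simp add: couplings_def)
qed

end

section \<open>Lower bound for the relative entropy\<close>

text \<open>The bound \<open>KL(\<gamma> | Q) \<ge> \<integral> \<phi> d\<gamma> + 1 - \<integral> exp \<phi> dQ\<close> of Donsker and Varadhan, up to
  \<open>1 - s \<le> - ln s\<close>. It follows from \<open>ln w \<le> w - 1\<close> at \<open>w = exp \<phi> * q / p\<close>. The
  pointwise form with an integrable remainder is kept, because \<open>ln p\<close> and \<open>ln q\<close> need not be
  integrable separately, so that the difference of their integrals may be undefined.\<close>
lemma relative_entropy_variational:
  fixes p q \<phi> :: "'b::euclidean_space \<Rightarrow> real"
  assumes \<gamma>: "\<gamma> = density lborel (\<lambda>z. ennreal (p z))" "prob_space \<gamma>"
    and [measurable]: "p \<in> borel_measurable borel" and p: "\<And>z. 0 \<le> p z"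
    and Q: "Q = density lborel (\<lambda>z. ennreal (q z))" "prob_space Q"
    and [measurable]: "q \<in> borel_measurable borel" and q: "\<And>z. 0 \<le> q z"
    and q_pos: "AE z in \<gamma>. 0 < q z"
    and [measurable]: "\<phi> \<in> borel_measurable borel" and \<phi>: "\<And>z. \<bar>\<phi> z\<bar> \<le> c"
  shows "integrable \<gamma> (\<lambda>z. \<phi> z + 1 - q z / p z * exp (\<phi> z))" (is "integrable \<gamma> ?h")
    and "AE z in \<gamma>. ln (q z) + (\<phi> z + 1 - q z / p z * exp (\<phi> z)) \<le> ln (p z)"
    and "(\<integral>z. \<phi> z \<partial>\<gamma>) + 1 - (\<integral>z. exp (\<phi> z) \<partial>Q) \<le> (\<integral>z. \<phi> z + 1 - q z / p z * exp (\<phi> z) \<partial>\<gamma>)"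
proof -
  interpret \<gamma>: prob_space \<gamma> by fact
  interpret Q: prob_space Q by fact
  have [measurable_cong]: "sets \<gamma> = sets borel" "sets Q = sets borel" by (auto simp: \<gamma> Q)
  have i\<phi>: "integrable \<gamma> \<phi>"
    using \<phi> by (intro \<gamma>.integrable_const_bound[of _ c]) auto
  have ie: "integrable Q (\<lambda>z. exp (\<phi> z))"
    using \<phi> by (intro Q.integrable_const_bound[of _ "exp c"]) (auto intro: order_trans[OF abs_ge_self])
  have "(\<integral>\<^sup>+ z. ennreal (q z / p z * exp (\<phi> z)) \<partial>\<gamma>) \<le> (\<integral>\<^sup>+ z. ennreal (q z * exp (\<phi> z)) \<partial>lborel)"
    using nn_integral_ratio_le[of p lborel "\<lambda>z. q z * exp (\<phi> z)"] p q unfolding \<gamma>(1) by simp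
  also have "\<dots> = (\<integral>\<^sup>+ z. ennreal (exp (\<phi> z)) \<partial>Q)"
    using q by (simp add: Q(1) nn_integral_density ennreal_mult)
  also have "\<dots> = ennreal (\<integral>z. exp (\<phi> z) \<partial>Q)"
    using ie by (subst nn_integral_eq_integral) auto
  finally have le: "(\<integral>\<^sup>+ z. ennreal (q z / p z * exp (\<phi> z)) \<partial>\<gamma>) \<le> ennreal (\<integral>z. exp (\<phi> z) \<partial>Q)" .
  have iw: "integrable \<gamma> (\<lambda>z. q z / p z * exp (\<phi> z))"
    by (rule integrableI_nonneg) (use le p q in \<open>auto simp: order_le_less_trans\<close>)
  have "(\<integral>z. q z / p z * exp (\<phi> z) \<partial>\<gamma>) \<le> (\<integral>z. exp (\<phi> z) \<partial>Q)"
    using le p q by (subst integral_eq_nn_integral) (auto intro!: enn2real_leI)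
  then show "(\<integral>z. \<phi> z \<partial>\<gamma>) + 1 - (\<integral>z. exp (\<phi> z) \<partial>Q) \<le> (\<integral>z. ?h z \<partial>\<gamma>)"
    using i\<phi> iw by (simp add: \<gamma>.prob_space)
  show "integrable \<gamma> ?h" using i\<phi> iw by auto
  have "AE z in \<gamma>. 0 < p z" using AE_density_pos[of p lborel, folded \<gamma>(1)] by simp
  then show "AE z in \<gamma>. ln (q z) + ?h z \<le> ln (p z)"
    using q_pos
  proof eventually_elim
    case (elim z)
    have "ln (q z / p z * exp (\<phi> z)) \<le> q z / p z * exp (\<phi> z) - 1"
      using elim by (intro ln_le_minus_one) auto
    moreover have "ln (q z / p z * exp (\<phi> z)) = ln (q z) - ln (p z) + \<phi> z"
      using elim by (simp add: ln_mult ln_div)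
    ultimately show ?case by simp
  qed
qed

lemma coupling_AE_fst:
  assumes "\<gamma> \<in> couplings \<mu> \<nu>" "AE y in \<mu>. P y"
  shows "AE z in \<gamma>. P (fst z)"
proof (rule AE_distrD[OF couplingsD(5)[OF assms(1)]])
  show "AE y in distr \<gamma> borel fst. P y"
    unfolding couplingsD(3)[OF assms(1)] by (rule assms(2))
qed

text \<open>If \<open>N\<close> is a null set, so is the cylinder over it, although its other side has infinite
  measure.\<close>
lemma coupling_absolutely_continuous_fst:
  fixes \<gamma> :: "('a::euclidean_space \<times> 'a) measure"
  assumes "\<gamma> \<in> couplings \<mu> \<nu>" "absolutely_continuous lborel \<gamma>"
  shows "absolutely_continuous lborel \<mu>"
  unfolding absolutely_continuous_def
proof
  fix N :: "'a set" assume N: "N \<in> null_sets lborel"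
  then have [measurable]: "N \<in> sets borel" by auto
  have "N \<times> (UNIV :: 'a set) \<in> null_sets (lborel \<Otimes>\<^sub>M lborel)"
    using N by (auto simp: null_sets_def lborel.emeasure_pair_measure_Times)
  then have "N \<times> (UNIV :: 'a set) \<in> null_sets \<gamma>"
    using assms(2) by (auto simp: lborel_prod absolutely_continuous_def)
  moreover have "fst -` N \<inter> space \<gamma> = N \<times> UNIV"
    using sets_eq_imp_space_eq[OF couplingsD(2)[OF assms(1)]] by auto
  moreover have "emeasure \<mu> N = emeasure \<gamma> (fst -` N \<inter> space \<gamma>)"
    using couplingsD(5)[OF assms(1)] by (subst couplingsD(3)[OF assms(1), symmetric]) (simp add: emeasure_distr)
  ultimately show "N \<in> null_sets \<mu>"
    using couplingsD(3)[OF assms(1)] by (auto simp: null_sets_def)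
qed

lemma (in proximal_kernel) ln_joint:
  assumes "0 < r (fst z)"
  shows "ln (joint r z) = ln (r (fst z)) - ln (Z (fst z)) - f (snd z) - (norm (snd z - fst z))\<^sup>2 / (2 * \<eta>)"
  using assms k_pos[of "fst z" "snd z"] by (simp add: joint_def ln_mult ln_k)

section \<open>The one-step minimisation problem\<close>

context proximal_kernel
begin

text \<open>The objective of a coupling is at least \<open>\<integral> (ln r - ln Z) d\<rho>\<close>, the value that the joint law attains,
  plus the variational lower bound for the relative entropy with respect to the joint law. The function \<open>\<phi>\<close> depends on \<open>x\<close> only, so the
  bound does not see which coupling of \<open>\<rho>\<close> and \<open>\<mu>\<close> is used.\<close>
lemma free_energy_lower_bound:
  assumes \<rho>: "\<rho> = density lborel (\<lambda>y. ennreal (r y))" "prob_space \<rho>"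
    and [measurable]: "r \<in> borel_measurable borel" and r: "\<And>y. 0 \<le> r y"
    and ir: "integrable \<rho> (\<lambda>y. ln (r y))" and iZ: "integrable \<rho> (\<lambda>y. ln (Z y))"
    and \<gamma>: "\<gamma> \<in> couplings \<rho> \<mu>" and B [measurable]: "B \<in> sets borel"
  shows "ereal ((\<integral>y. ln (r y) - ln (Z y) \<partial>\<rho>) + t * measure \<mu> B
      - (exp t - 1) * measure (\<rho> \<bind> backward_kernel f \<eta>) B)
    \<le> ereal_integral \<mu> f + (ereal_integral \<gamma> (\<lambda>z. (norm (snd z - fst z))\<^sup>2 / (2 * \<eta>)) + neg_entropy \<gamma>)"
proof (cases "neg_entropy \<gamma> < \<infinity>")
  case False
  then show ?thesis by simp
next
  case True
  let ?\<rho>' = "\<rho> \<bind> backward_kernel f \<eta>"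
  define G where "G = density lborel (\<lambda>z. ennreal (joint r z))"
  have G: "G \<in> couplings \<rho> ?\<rho>'" unfolding G_def by (rule joint_coupling) (fact \<rho> r assms(3))+
  note d = couplingsD[OF \<gamma>]
  note [measurable] = d(5,6)
  note [measurable_cong] = d(2)
  interpret \<gamma>: prob_space \<gamma> by (rule d)
  interpret G: prob_space G by (rule couplingsD(1)[OF G])
  have s\<rho>: "sets \<rho> = sets borel" by (simp add: \<rho>)
  interpret \<rho>': prob_space ?\<rho>' by (rule bind_backward_kernel(1)[OF \<rho>(2) s\<rho>])
  have s\<rho>' [measurable_cong]: "sets ?\<rho>' = sets borel" by (rule bind_backward_kernel(2)[OF \<rho>(2) s\<rho>])
  obtain p where p [measurable]: "p \<in> borel_measurable borel" "\<And>z. 0 \<le> p z"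
    and \<gamma>p: "\<gamma> = density lborel (\<lambda>z. ennreal (p z))"
    using neg_entropy_finite_density[OF True d(2) d(1)] by blast
  have "AE y in \<rho>. 0 < r y" using AE_density_pos[of r lborel, folded \<rho>(1)] by simp
  then have r_pos: "AE z in \<gamma>. 0 < r (fst z)" by (rule coupling_AE_fst[OF \<gamma>])
  then have q_pos: "AE z in \<gamma>. 0 < joint r z"
    by eventually_elim (simp add: joint_def k_pos)
  have snd_m [measurable]: "snd \<in> measurable (borel :: ('a \<times> 'a) measure) borel"
    unfolding borel_prod[symmetric] by measurable
  let ?\<phi> = "\<lambda>z::'a\<times>'a. t * indicator B (snd z)"
  have q0: "0 \<le> joint r z" for z using r k_pos by (simp add: joint_def less_imp_le)
  have \<phi>m: "?\<phi> \<in> borel_measurable borel" by measurable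
  have \<phi>b: "\<bar>?\<phi> z\<bar> \<le> \<bar>t\<bar>" for z by (auto simp: indicator_def)
  note V = relative_entropy_variational[OF \<gamma>p d(1) p G_def G.prob_space_axioms measurable_joint[OF assms(3)] q0 q_pos \<phi>m \<phi>b]
  let ?h = "\<lambda>z. ?\<phi> z + 1 - joint r z / p z * exp (?\<phi> z)"
  let ?b = "\<lambda>y. ln (r y) - ln (Z y)"
  have bm: "?b \<in> borel_measurable borel" by measurable
  have ib: "integrable \<gamma> (\<lambda>z. ?b (fst z))"
    using ir iZ integrable_coupling(1)[OF \<gamma> bm] by auto
  have "(\<integral>z. exp (?\<phi> z) \<partial>G) = (\<integral>x. exp (t * indicator B x) \<partial>?\<rho>')"
    by (rule integrable_coupling(4)[OF G]) auto
  also have "\<dots> = (\<integral>x. 1 + (exp t - 1) * indicator B x \<partial>?\<rho>')"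
    by (intro Bochner_Integration.integral_cong) (auto simp: indicator_def)
  also have "\<dots> = 1 + (exp t - 1) * measure ?\<rho>' B"
    using s\<rho>' by (subst Bochner_Integration.integral_add)
      (auto simp: \<rho>'.prob_space \<rho>'.emeasure_eq_measure intro!: \<rho>'.integrable_const_bound[of _ 1])
  finally have E: "(\<integral>z. exp (?\<phi> z) \<partial>G) = 1 + (exp t - 1) * measure ?\<rho>' B" .
  have "(\<integral>z. ?\<phi> z \<partial>\<gamma>) = (\<integral>x. t * indicator B x \<partial>\<mu>)"
    by (rule integrable_coupling(4)[OF \<gamma>]) auto
  also have "\<dots> = t * measure \<mu> B"
    using d(4) by (auto dest!: sets_eq_imp_space_eq[of _ borel] sym[of "distr _ _ _"])
  finally have P: "(\<integral>z. ?\<phi> z \<partial>\<gamma>) = t * measure \<mu> B" .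
  have "ereal ((\<integral>y. ?b y \<partial>\<rho>) + t * measure \<mu> B - (exp t - 1) * measure ?\<rho>' B)
      \<le> ereal (\<integral>z. ?b (fst z) + ?h z \<partial>\<gamma>)"
    using V(3) ib V(1) integrable_coupling(3)[OF \<gamma> bm] unfolding E P by simp
  also have "\<dots> \<le> ereal_integral \<gamma> (\<lambda>z. f (snd z)) +
      (ereal_integral \<gamma> (\<lambda>z. (norm (snd z - fst z))\<^sup>2 / (2 * \<eta>)) + ereal_integral \<gamma> (\<lambda>z. ln (p z)))"
  proof (rule integral_le_ereal_integral_sum)
    show "integrable \<gamma> (\<lambda>z. ?b (fst z) + ?h z)" using ib V(1) by auto
    show "AE z in \<gamma>. ?b (fst z) + ?h z \<le> f (snd z) + (norm (snd z - fst z))\<^sup>2 / (2 * \<eta>) + ln (p z)"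
      using V(2) r_pos by eventually_elim (simp add: ln_joint)
  qed auto
  also have "ereal_integral \<gamma> (\<lambda>z. f (snd z)) = ereal_integral \<mu> f"
    using ereal_integral_distr[OF d(6) f_measurable] d(4) by simp
  also have "ereal_integral \<gamma> (\<lambda>z. ln (p z)) = neg_entropy \<gamma>"
    by (rule neg_entropy_density[OF \<gamma>p d(1) p, symmetric])
  finally show ?thesis .
qed

text \<open>At the joint law \<open>ln p\<close> cancels the cost and \<open>f\<close> up to a function of \<open>y\<close>. The point is
  that all terms are integrable: \<open>f\<^sup>-\<close> by hypothesis, and \<open>f\<^sup>+\<close> because the joint law has a finite
  second moment, so that the negative part of its log-density is integrable.\<close>
lemma free_energy_joint:
  assumes \<rho>: "\<rho> = density lborel (\<lambda>y. ennreal (r y))" "\<rho> \<in> P2"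
    and [measurable]: "r \<in> borel_measurable borel" and r: "\<And>y. 0 \<le> r y"
    and ir: "integrable \<rho> (\<lambda>y. ln (r y))" and iZ: "integrable \<rho> (\<lambda>y. ln (Z y))"
    and \<rho>': "\<rho> \<bind> backward_kernel f \<eta> \<in> P2" "(\<integral>\<^sup>+ x. ennreal (- f x) \<partial>(\<rho> \<bind> backward_kernel f \<eta>)) < \<infinity>"
  defines "G \<equiv> density lborel (\<lambda>z. ennreal (joint r z))"
  shows "ereal_integral (\<rho> \<bind> backward_kernel f \<eta>) f
        + (ereal_integral G (\<lambda>z. (norm (snd z - fst z))\<^sup>2 / (2 * \<eta>)) + neg_entropy G)
      = ereal (\<integral>y. ln (r y) - ln (Z y) \<partial>\<rho>)"
proof -
  let ?\<rho>' = "\<rho> \<bind> backward_kernel f \<eta>"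
  have G: "G \<in> couplings \<rho> ?\<rho>'"
    unfolding G_def by (rule joint_coupling) (fact \<rho> r assms(3) P2D(1)[OF \<rho>(2)])+
  note d = couplingsD[OF G]
  note [measurable] = d(5,6)
  note [measurable_cong] = d(2)
  interpret G: prob_space G by (rule d)
  have q0: "0 \<le> joint r z" for z using r k_pos by (simp add: joint_def less_imp_le)
  have "AE y in \<rho>. 0 < r y" using AE_density_pos[of r lborel, folded \<rho>(1)] by simp
  then have r_pos: "AE z in G. 0 < r (fst z)" by (rule coupling_AE_fst[OF G])
  let ?b = "\<lambda>y. ln (r y) - ln (Z y)" and ?s = "\<lambda>z. (norm (snd z - fst z))\<^sup>2 / (2 * \<eta>)"
  have bm: "?b \<in> borel_measurable borel" by measurable
  have jm: "(\<lambda>z. ln (joint r z)) \<in> borel_measurable borel"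
    using measurable_joint[OF assms(3)] by measurable
  have ib: "integrable G (\<lambda>z. ?b (fst z))"
    using ir iZ integrable_coupling(1)[OF G bm] by auto
  have isq: "integrable G ?s"
    using integrable_transport_cost[OF G \<rho>(2) \<rho>'(1)] by (simp add: norm_minus_commute)
  have eq: "AE z in G. ln (joint r z) = ?b (fst z) - f (snd z) - ?s z"
    using r_pos by eventually_elim (simp add: ln_joint)
  have neg: "(\<integral>\<^sup>+ z. ennreal (- ln (joint r z)) \<partial>G) < \<infinity>"
    by (rule nn_integral_neg_ln_density_finite[OF coupling_in_P2[OF G \<rho>(2) \<rho>'(1)] G_def[THEN meta_eq_to_obj_eq] measurable_joint[OF assms(3)] q0])
  have ineg: "integrable G (\<lambda>z. max 0 (- ln (joint r z)))"
    using neg jm by (intro integrable_pos_part) auto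
  have fG: "(\<integral>\<^sup>+ z. ennreal (- f (snd z)) \<partial>G) < \<infinity>"
  proof -
    have "(\<integral>\<^sup>+ x. ennreal (- f x) \<partial>distr G borel snd) < \<infinity>"
      unfolding d(4) by (rule \<rho>'(2))
    then show ?thesis by (simp add: nn_integral_distr)
  qed
  have "(\<integral>\<^sup>+ z. ennreal (f (snd z)) \<partial>G) < \<infinity>"
  proof (rule nn_integral_pos_part_less_top)
    show "integrable G (\<lambda>z. \<bar>?b (fst z)\<bar> + max 0 (- ln (joint r z)))" using ib ineg by auto
    show "AE z in G. f (snd z) \<le> \<bar>?b (fst z)\<bar> + max 0 (- ln (joint r z))"
      using eq
    proof eventually_elim
      case (elim z)
      have "0 \<le> ?s z" using eta by simp
      then show ?case using elim by (auto simp: max_def abs_if)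
    qed
  qed
  then have ifG: "integrable G (\<lambda>z. f (snd z))"
    using fG by (auto simp: real_integrable_def)
  then have if\<rho>: "integrable ?\<rho>' f"
    using integrable_coupling(2)[OF G f_measurable] by simp
  have "neg_entropy G = ereal_integral G (\<lambda>z. ln (joint r z))"
    by (rule neg_entropy_density[OF G_def[THEN meta_eq_to_obj_eq] d(1) measurable_joint[OF assms(3)] q0])
  also have "\<dots> = ereal_integral G (\<lambda>z. ?b (fst z) - f (snd z) - ?s z)"
    by (rule ereal_integral_cong_AE[OF eq])
  also have "\<dots> = ereal ((\<integral>y. ?b y \<partial>\<rho>) - (\<integral>x. f x \<partial>?\<rho>') - (\<integral>z. ?s z \<partial>G))"
    using ib ifG isq integrable_coupling(3)[OF G bm] integrable_coupling(4)[OF G f_measurable]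
    by (subst ereal_integral_eq_integral) auto
  finally show "ereal_integral ?\<rho>' f + (ereal_integral G ?s + neg_entropy G) = ereal (\<integral>y. ?b y \<partial>\<rho>)"
    using if\<rho> isq by (simp add: ereal_integral_eq_integral)
qed

text \<open>Marginals inherit finite entropy. The variational bound with \<open>\<phi> = 0\<close>, relative to the joint law
  built on the density \<open>r\<close> of the first marginal, bounds \<open>ln r\<close> from above by \<open>ln p\<close>, the cost and
  integrable terms.\<close>
lemma neg_entropy_fst_finite:
  assumes \<gamma>: "\<gamma> \<in> couplings \<rho> \<mu>" and H: "neg_entropy \<gamma> < \<infinity>" and P2: "\<rho> \<in> P2" "\<mu> \<in> P2"
    and if\<mu>: "integrable \<mu> f" and iZ: "integrable \<rho> (\<lambda>y. ln (Z y))"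
  shows "neg_entropy \<rho> < \<infinity>"
proof -
  note d = couplingsD[OF \<gamma>]
  note [measurable] = d(5,6)
  note [measurable_cong] = d(2)
  interpret \<gamma>: prob_space \<gamma> by (rule d)
  have "absolutely_continuous lborel \<gamma>"
    using H by (auto simp: neg_entropy_def split: if_splits)
  then have ac: "absolutely_continuous lborel \<rho>"
    by (rule coupling_absolutely_continuous_fst[OF \<gamma>])
  obtain r where r [measurable]: "r \<in> borel_measurable borel" and r0: "\<And>y. 0 \<le> r y"
    and \<rho>: "\<rho> = density lborel (\<lambda>y. ennreal (r y))"
    using absolutely_continuous_density[OF ac P2D(2,1)[OF P2(1)]] by blast
  obtain p where p [measurable]: "p \<in> borel_measurable borel" "\<And>z. 0 \<le> p z"
    and \<gamma>p: "\<gamma> = density lborel (\<lambda>z. ennreal (p z))"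
    using neg_entropy_finite_density[OF H d(2) d(1)] by blast
  define G where "G = density lborel (\<lambda>z. ennreal (joint r z))"
  have G: "G \<in> couplings \<rho> (\<rho> \<bind> backward_kernel f \<eta>)"
    unfolding G_def by (rule joint_coupling) (fact \<rho> r r0 P2D(1)[OF P2(1)])+
  have "AE y in \<rho>. 0 < r y" using AE_density_pos[of r lborel, folded \<rho>] by simp
  then have r_pos: "AE z in \<gamma>. 0 < r (fst z)" by (rule coupling_AE_fst[OF \<gamma>])
  then have q_pos: "AE z in \<gamma>. 0 < joint r z"
    by eventually_elim (simp add: joint_def k_pos)
  have q0: "0 \<le> joint r z" for z using r0 k_pos by (simp add: joint_def less_imp_le)
  note V = relative_entropy_variational[OF \<gamma>p d(1) p G_def couplingsD(1)[OF G] measurable_joint[OF r] q0 q_pos,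
     where \<phi> = "\<lambda>_. 0" and c = 0, simplified]
  have Hp: "neg_entropy \<gamma> = ereal_integral \<gamma> (\<lambda>z. ln (p z))"
    by (rule neg_entropy_density[OF \<gamma>p d(1) p])
  have ip: "integrable \<gamma> (\<lambda>z. max 0 (ln (p z)))"
    using H unfolding Hp ereal_integral_less_top_iff by (intro integrable_pos_part) auto
  have iZ': "integrable \<gamma> (\<lambda>z. ln (Z (fst z)))"
    using integrable_coupling(1)[OF \<gamma>, of "\<lambda>y. ln (Z y)"] iZ by simp
  have if': "integrable \<gamma> (\<lambda>z. f (snd z))"
    using integrable_coupling(2)[OF \<gamma> f_measurable] if\<mu> by simp
  have isq: "integrable \<gamma> (\<lambda>z. (norm (snd z - fst z))\<^sup>2 / (2 * \<eta>))"
    using integrable_transport_cost[OF \<gamma> P2] by (simp add: norm_minus_commute)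
  have "(\<integral>\<^sup>+ z. ennreal (ln (r (fst z))) \<partial>\<gamma>) < \<infinity>"
  proof (rule nn_integral_pos_part_less_top)
    show "integrable \<gamma> (\<lambda>z. max 0 (ln (p z)) + ln (Z (fst z)) + f (snd z)
        + (norm (snd z - fst z))\<^sup>2 / (2 * \<eta>) - (1 - joint r z / p z))"
      using ip iZ' if' isq V(1) by auto
    show "AE z in \<gamma>. ln (r (fst z)) \<le> max 0 (ln (p z)) + ln (Z (fst z)) + f (snd z)
        + (norm (snd z - fst z))\<^sup>2 / (2 * \<eta>) - (1 - joint r z / p z)"
      using V(2) r_pos by eventually_elim (auto simp: ln_joint max_def)
  qed
  then have "(\<integral>\<^sup>+ y. ennreal (ln (r y)) \<partial>\<rho>) < \<infinity>"
    by (subst d(3)[symmetric], subst nn_integral_distr) auto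
  then have "ereal_integral \<rho> (\<lambda>y. ln (r y)) < \<infinity>"
    unfolding ereal_integral_less_top_iff .
  then show ?thesis
    by (simp add: neg_entropy_density[OF \<rho> P2D(1)[OF P2(1)] r r0])
qed

text \<open>The value at \<open>\<rho>'\<close> is at most the objective \<open>K\<close> of the joint law. For \<open>\<mu> \<noteq> \<rho>'\<close> some set \<open>B\<close>
  has \<open>\<mu> B > \<rho>' B\<close>, and the lower bound with a small \<open>t > 0\<close> exceeds \<open>K\<close>.\<close>
lemma proximal_step_argmin:
  assumes \<rho>: "\<rho> \<in> P2" "neg_entropy \<rho> < \<infinity>" and iZ: "integrable \<rho> (\<lambda>y. ln (Z y))"
    and \<rho>': "\<rho> \<bind> backward_kernel f \<eta> \<in> P2" "(\<integral>\<^sup>+ x. ennreal (- f x) \<partial>(\<rho> \<bind> backward_kernel f \<eta>)) < \<infinity>"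
  shows "argmin_on P2 (\<lambda>\<mu>. ereal_integral \<mu> f + ereal (1 / (2 * \<eta>)) * entropic_W2_sq (2 * \<eta>) \<rho> \<mu>)
    = {\<rho> \<bind> backward_kernel f \<eta>}"
proof -
  let ?\<rho>' = "\<rho> \<bind> backward_kernel f \<eta>"
  let ?F = "\<lambda>\<mu>. ereal_integral \<mu> f + ereal (1 / (2 * \<eta>)) * entropic_W2_sq (2 * \<eta>) \<rho> \<mu>"
  obtain r where r [measurable]: "r \<in> borel_measurable borel" and r0: "\<And>y. 0 \<le> r y"
    and \<rho>r: "\<rho> = density lborel (\<lambda>y. ennreal (r y))"
    using neg_entropy_finite_density[OF \<rho>(2) P2D(2,1)[OF \<rho>(1)]] by blast
  note p\<rho> = P2D(1)[OF \<rho>(1)]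
  have [measurable_cong]: "sets \<rho> = sets borel" by (rule P2D(2)[OF \<rho>(1)])
  have H: "neg_entropy \<rho> = ereal_integral \<rho> (\<lambda>y. ln (r y))"
    by (rule neg_entropy_density[OF \<rho>r p\<rho> r r0])
  have "(\<integral>\<^sup>+ y. ennreal (ln (r y)) \<partial>\<rho>) < \<infinity>"
    using \<rho>(2) unfolding H ereal_integral_less_top_iff .
  then have ir: "integrable \<rho> (\<lambda>y. ln (r y))"
    using nn_integral_neg_ln_density_finite[OF \<rho>(1) \<rho>r r r0] by (auto simp: real_integrable_def)
  define K where "K = (\<integral>y. ln (r y) - ln (Z y) \<partial>\<rho>)"
  have lower: "ereal (K + t * measure \<mu> B - (exp t - 1) * measure ?\<rho>' B) \<le> ?F \<mu>"
    if [measurable]: "B \<in> sets borel" for \<mu> B t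
    unfolding entropic_W2_sq_def
  proof (rule le_add_INF)
    fix \<gamma> assume \<gamma>: "\<gamma> \<in> couplings \<rho> \<mu>"
    show "ereal (K + t * measure \<mu> B - (exp t - 1) * measure ?\<rho>' B) \<le> ereal_integral \<mu> f + ereal (1 / (2 * \<eta>)) *
      (enn2ereal (\<integral>\<^sup>+ z. ennreal ((norm (fst z - snd z))\<^sup>2) \<partial>\<gamma>) + ereal (2 * \<eta>) * neg_entropy \<gamma>)"
      unfolding entropic_cost_eq[OF eta couplingsD(2)[OF \<gamma>]] K_def
      by (rule free_energy_lower_bound[OF \<rho>r p\<rho> r r0 ir iZ \<gamma> that])
  qed (use eta in auto)
  have upper: "?F ?\<rho>' \<le> ereal K"
  proof -
    let ?G = "density lborel (\<lambda>z. ennreal (joint r z))"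
    have G: "?G \<in> couplings \<rho> ?\<rho>'" by (rule joint_coupling[OF \<rho>r p\<rho> r r0])
    have "?F ?\<rho>' \<le> ereal_integral ?\<rho>' f + ereal (1 / (2 * \<eta>)) *
      (enn2ereal (\<integral>\<^sup>+ z. ennreal ((norm (fst z - snd z))\<^sup>2) \<partial>?G) + ereal (2 * \<eta>) * neg_entropy ?G)"
      unfolding entropic_W2_sq_def using eta
      by (intro add_left_mono ereal_mult_left_mono INF_lower G) auto
    also have "\<dots> = ereal K"
      unfolding entropic_cost_eq[OF eta couplingsD(2)[OF G]] K_def
      by (rule free_energy_joint[OF \<rho>r \<rho>(1) r r0 ir iZ \<rho>'])
    finally show ?thesis .
  qed
  have strict: "?F ?\<rho>' < ?F \<mu>" if \<mu>: "\<mu> \<in> P2" "\<mu> \<noteq> ?\<rho>'" for \<mu>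
  proof -
    interpret \<mu>: prob_space \<mu> by (rule P2D(1)[OF \<mu>(1)])
    interpret \<rho>': prob_space ?\<rho>' by (rule P2D(1)[OF \<rho>'(1)])
    note s = P2D(2,3)[OF \<mu>(1)] P2D(2,3)[OF \<rho>'(1)]
    obtain A where A: "A \<in> sets borel" "measure \<mu> A \<noteq> measure ?\<rho>' A"
      using measure_eqI[of \<mu> ?\<rho>'] \<mu>(2) s by (auto simp: \<mu>.emeasure_eq_measure \<rho>'.emeasure_eq_measure)
    have "\<exists>B\<in>sets borel. measure ?\<rho>' B < measure \<mu> B"
    proof (cases "measure ?\<rho>' A < measure \<mu> A")
      case False
      have "measure \<mu> (UNIV - A) = 1 - measure \<mu> A" "measure ?\<rho>' (UNIV - A) = 1 - measure ?\<rho>' A"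
        using \<mu>.prob_compl[of A] \<rho>'.prob_compl[of A] A(1) s by auto
      then show ?thesis using False A by (intro bexI[of _ "UNIV - A"]) auto
    qed (use A in blast)
    then obtain B where B: "B \<in> sets borel" "measure ?\<rho>' B < measure \<mu> B" by blast
    \<comment> \<open>\<open>t = \<delta> / 2\<close> maximises \<open>t \<delta> - t\<^sup>2\<close>, a lower bound for
      \<open>t \<mu> B - (exp t - 1) \<rho>' B\<close> when \<open>0 \<le> t \<le> 1\<close>.\<close>
    define \<delta> where "\<delta> = measure \<mu> B - measure ?\<rho>' B"
    have \<delta>: "0 < \<delta>" "\<delta> \<le> 1"
      unfolding \<delta>_def using B(2) \<mu>.prob_le_1[of B] measure_nonneg[of ?\<rho>' B] by linarith+
    have "exp (\<delta> / 2) \<le> 1 + \<delta> / 2 + (\<delta> / 2)\<^sup>2" using \<delta> by (intro exp_bound) auto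
    then have "(exp (\<delta> / 2) - 1) * measure ?\<rho>' B \<le> (\<delta> / 2 + (\<delta> / 2)\<^sup>2) * measure ?\<rho>' B"
      by (intro mult_right_mono) auto
    also have "\<dots> \<le> \<delta> / 2 * measure ?\<rho>' B + (\<delta> / 2)\<^sup>2"
      using mult_left_mono[OF \<rho>'.prob_le_1[of B], of "(\<delta> / 2)\<^sup>2"] by (simp add: algebra_simps)
    also have "\<dots> = \<delta> / 2 * measure \<mu> B - \<delta>\<^sup>2 / 4"
      by (simp add: \<delta>_def power2_eq_square field_simps)
    finally have "K < K + \<delta> / 2 * measure \<mu> B - (exp (\<delta> / 2) - 1) * measure ?\<rho>' B"
      using \<delta> zero_less_power[of \<delta> 2] by linarith
    then have "ereal K < ereal (K + \<delta> / 2 * measure \<mu> B - (exp (\<delta> / 2) - 1) * measure ?\<rho>' B)" by simp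
    also have "\<dots> \<le> ?F \<mu>" by (rule lower[OF B(1)])
    finally show ?thesis using upper by (rule le_less_trans[rotated])
  qed
  have "\<mu> \<in> argmin_on P2 ?F \<longleftrightarrow> \<mu> = ?\<rho>'" for \<mu>
    using strict \<rho>'(1) unfolding argmin_on_def is_arg_min_def by (auto dest: less_asym)
  then show ?thesis by blast
qed

section \<open>Second moment and entropy after a step\<close>
lemma bind_backward_kernel_in_P2:
  assumes \<rho>: "\<rho> \<in> P2" and A: "0 \<le> A" "0 \<le> B"
    and le: "\<And>y. (\<integral>\<^sup>+ x. ennreal (k y x * (norm (x - y))\<^sup>2) \<partial>lborel) \<le> ennreal (A + B * (norm y)\<^sup>2)"
  shows "\<rho> \<bind> backward_kernel f \<eta> \<in> P2"
proof -
  note p = P2D(1,2)[OF \<rho>]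
  interpret prob_space \<rho> by (rule p)
  have "(\<integral>\<^sup>+ x. ennreal (k y x) * ennreal ((norm x)\<^sup>2) \<partial>lborel) \<le> ennreal (2 * A + (2 * B + 2) * (norm y)\<^sup>2)" for y
  proof -
    have "(\<integral>\<^sup>+ x. ennreal (k y x) * ennreal ((norm x)\<^sup>2) \<partial>lborel)
      \<le> (\<integral>\<^sup>+ x. 2 * ennreal (k y x * (norm (x - y))\<^sup>2) + ennreal (2 * (norm y)\<^sup>2) * ennreal (k y x) \<partial>lborel)"
    proof (rule nn_integral_mono)
      fix x
      have "(norm x)\<^sup>2 \<le> 2 * (norm (x - y))\<^sup>2 + 2 * (norm y)\<^sup>2"
        using norm_diff_sq_le[of "x - y" "- y"] by simp
      then have "k y x * (norm x)\<^sup>2 \<le> 2 * (k y x * (norm (x - y))\<^sup>2) + 2 * (norm y)\<^sup>2 * k y x"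
        using mult_left_mono[OF _ less_imp_le[OF k_pos[of y x]]] by (fastforce simp: algebra_simps)
      then show "ennreal (k y x) * ennreal ((norm x)\<^sup>2)
          \<le> 2 * ennreal (k y x * (norm (x - y))\<^sup>2) + ennreal (2 * (norm y)\<^sup>2) * ennreal (k y x)"
        using k_pos[of y x]
        by (auto simp: ennreal_mult[symmetric] ennreal_plus[symmetric] ennreal_numeral[symmetric] less_imp_le
            simp del: ennreal_plus ennreal_numeral intro!: ennreal_leI)
    qed
    also have "\<dots> = 2 * (\<integral>\<^sup>+ x. ennreal (k y x * (norm (x - y))\<^sup>2) \<partial>lborel) + ennreal (2 * (norm y)\<^sup>2)"
      by (subst nn_integral_add) (auto simp: nn_integral_cmult nn_integral_k)
    also have "\<dots> \<le> 2 * ennreal (A + B * (norm y)\<^sup>2) + ennreal (2 * (norm y)\<^sup>2)"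
      by (intro add_right_mono mult_left_mono le) auto
    also have "\<dots> = ennreal (2 * A + (2 * B + 2) * (norm y)\<^sup>2)"
      using A by (auto simp: ennreal_mult[symmetric] ennreal_plus[symmetric] ennreal_numeral[symmetric] algebra_simps
            simp del: ennreal_plus ennreal_numeral)
    finally show ?thesis .
  qed
  then have "(\<integral>\<^sup>+ x. ennreal ((norm x)\<^sup>2) \<partial>(\<rho> \<bind> backward_kernel f \<eta>))
      \<le> (\<integral>\<^sup>+ y. ennreal (2 * A + (2 * B + 2) * (norm y)\<^sup>2) \<partial>\<rho>)"
    by (subst bind_backward_kernel(3)[OF p]) (auto intro!: nn_integral_mono)
  also have "\<dots> < \<infinity>"
    using P2D(5)[OF \<rho>] by (intro nn_integral_pos_part_less_top[OF _ AE_I2[OF order_refl]]) auto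
  finally show ?thesis
    using bind_backward_kernel(1,2)[OF p] by (auto simp: P2_def)
qed

text \<open>A bound \<open>k \<le> c\<close> gives \<open>\<rho>' \<le> c\<close> times Lebesgue measure. The density \<open>r\<close> of \<open>\<rho>'\<close> then
  satisfies \<open>\<integral> (ln r)\<^sup>+ d\<rho>' \<le> c \<integral> (ln r)\<^sup>+ dx \<le> c \<integral> r dx = c\<close>, which avoids computing \<open>r\<close>.\<close>
lemma neg_entropy_bind_backward_kernel_finite:
  assumes \<rho>: "prob_space \<rho>" "sets \<rho> = sets borel" and c: "\<And>y x. k y x \<le> c"
  shows "neg_entropy (\<rho> \<bind> backward_kernel f \<eta>) < \<infinity>"
proof -
  let ?\<rho>' = "\<rho> \<bind> backward_kernel f \<eta>"
  interpret \<rho>: prob_space \<rho> by (rule \<rho>)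
  note \<rho>' = bind_backward_kernel[OF \<rho>]
  interpret \<rho>': prob_space ?\<rho>' by (rule \<rho>'(1))
  have dom: "(\<integral>\<^sup>+ x. h x \<partial>?\<rho>') \<le> ennreal c * (\<integral>\<^sup>+ x. h x \<partial>lborel)" if [measurable]: "h \<in> borel_measurable borel" for h
  proof -
    have "(\<integral>\<^sup>+ x. h x \<partial>?\<rho>') \<le> (\<integral>\<^sup>+ y. \<integral>\<^sup>+ x. ennreal c * h x \<partial>lborel \<partial>\<rho>)"
      unfolding \<rho>'(3)[OF that] using c by (intro nn_integral_mono mult_right_mono) (auto intro: ennreal_leI)
    then show ?thesis by (simp add: nn_integral_cmult \<rho>.emeasure_space_1)
  qed
  have ac: "absolutely_continuous lborel ?\<rho>'"
    unfolding absolutely_continuous_def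
  proof
    fix N :: "'a set" assume N: "N \<in> null_sets lborel"
    then have [measurable]: "N \<in> sets borel" by auto
    have "emeasure ?\<rho>' N = (\<integral>\<^sup>+ x. indicator N x \<partial>?\<rho>')" using \<rho>'(2) by simp
    also have "\<dots> \<le> ennreal c * (\<integral>\<^sup>+ x. indicator N x \<partial>lborel)" by (rule dom) auto
    also have "\<dots> = 0" using N by (auto simp: null_sets_def)
    finally show "N \<in> null_sets ?\<rho>'" using \<rho>'(2) by (auto simp: null_sets_def)
  qed
  obtain r where r [measurable]: "r \<in> borel_measurable borel" and r0: "\<And>y. 0 \<le> r y"
    and eq: "?\<rho>' = density lborel (\<lambda>y. ennreal (r y))"
    using absolutely_continuous_density[OF ac \<rho>'(2,1)] by blast
  have "(\<integral>\<^sup>+ x. ennreal (ln (r x)) \<partial>?\<rho>') \<le> ennreal c * (\<integral>\<^sup>+ x. ennreal (ln (r x)) \<partial>lborel)"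
    by (rule dom) auto
  also have "\<dots> \<le> ennreal c * (\<integral>\<^sup>+ x. ennreal (r x) \<partial>lborel)"
  proof (intro mult_left_mono nn_integral_mono ennreal_leI)
    fix x show "ln (r x) \<le> r x" using r0[of x] by (cases "r x = 0") (auto intro!: ln_bound)
  qed auto
  also have "(\<integral>\<^sup>+ x. ennreal (r x) \<partial>lborel) = emeasure ?\<rho>' (space ?\<rho>')"
    unfolding eq by (simp add: emeasure_density)
  also have "ennreal c * \<dots> < \<infinity>" by (simp add: \<rho>'.emeasure_space_1)
  finally show ?thesis
    unfolding neg_entropy_density[OF eq \<rho>'(1) r r0] ereal_integral_less_top_iff .
qed

end

lemma integral_lborel_shift:
  fixes g :: "'a::euclidean_space \<Rightarrow> real"
  assumes [measurable]: "g \<in> borel_measurable borel"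
  shows "integrable lborel (\<lambda>x. g (x - y)) \<longleftrightarrow> integrable lborel g" "(\<integral>x. g (x - y) \<partial>lborel) = (\<integral>x. g x \<partial>lborel)"
proof -
  have e: "lborel = distr lborel borel (\<lambda>x. - y + x)" by (rule lborel_distr_plus[symmetric])
  show "integrable lborel (\<lambda>x. g (x - y)) \<longleftrightarrow> integrable lborel g"
    by (subst (2) e) (simp add: integrable_distr_eq)
  show "(\<integral>x. g (x - y) \<partial>lborel) = (\<integral>x. g x \<partial>lborel)"
    by (subst (2) e) (simp add: integral_distr)
qed

text \<open>The second part is the inequality of Jensen, by the tangent of \<open>exp\<close> at \<open>- E u\<close>.\<close>
lemma (in prob_space) exp_neg_expectation_le:
  assumes u: "integrable M u" "\<And>x. (0::real) \<le> u x"
  shows "integrable M (\<lambda>x. exp (- u x))" "exp (- expectation u) \<le> expectation (\<lambda>x. exp (- u x))"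
proof -
  have [measurable]: "u \<in> borel_measurable M" using u by auto
  show i: "integrable M (\<lambda>x. exp (- u x))"
    by (rule integrable_const_bound[of _ 1]) (use u in auto)
  let ?a = "expectation u"
  have "exp (- ?a) = expectation (\<lambda>x. exp (- ?a) * (1 + ?a - u x))"
    using u by (simp add: prob_space)
  also have "\<dots> \<le> expectation (\<lambda>x. exp (- u x))"
  proof (rule integral_mono)
    fix x
    have "exp (- ?a) * (1 + (?a - u x)) \<le> exp (- ?a) * exp (?a - u x)"
      by (intro mult_left_mono exp_ge_add_one_self) auto
    then show "exp (- ?a) * (1 + ?a - u x) \<le> exp (- u x)" by (simp add: exp_add[symmetric] algebra_simps)
  qed (use u i in auto)
  finally show "exp (- ?a) \<le> expectation (\<lambda>x. exp (- u x))" .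
qed

text \<open>The inequality of Chebyshev for the oppositely monotone functions \<open>u\<close> and \<open>exp (- u)\<close>: with
  \<open>a = E u\<close>, integrate \<open>(u - a) (exp (- u) - exp (- a)) \<le> 0\<close>.\<close>
lemma (in prob_space) expectation_mult_exp_neg_le:
  assumes u: "integrable M u" "\<And>x. (0::real) \<le> u x"
  shows "integrable M (\<lambda>x. u x * exp (- u x))"
    "expectation (\<lambda>x. u x * exp (- u x)) \<le> expectation u * expectation (\<lambda>x. exp (- u x))"
proof -
  have [measurable]: "u \<in> borel_measurable M" using u by auto
  have i: "integrable M (\<lambda>x. exp (- u x))" by (rule exp_neg_expectation_le[OF u])
  show iu: "integrable M (\<lambda>x. u x * exp (- u x))"
    by (rule Bochner_Integration.integrable_bound[OF u(1)])
      (use u in \<open>auto simp: abs_mult intro!: mult_left_le\<close>)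
  let ?a = "expectation u"
  have "expectation (\<lambda>x. u x * exp (- u x)) \<le> expectation (\<lambda>x. ?a * exp (- u x) + exp (- ?a) * (u x - ?a))"
  proof (rule integral_mono)
    fix x
    have "(u x - ?a) * (exp (- u x) - exp (- ?a)) \<le> 0"
      by (cases "u x \<le> ?a") (auto intro: mult_nonpos_nonneg mult_nonneg_nonpos)
    then show "u x * exp (- u x) \<le> ?a * exp (- u x) + exp (- ?a) * (u x - ?a)"
      by (simp add: algebra_simps)
  qed (use u i iu in auto)
  also have "\<dots> = ?a * expectation (\<lambda>x. exp (- u x))"
    using u i by (simp add: prob_space)
  finally show "expectation (\<lambda>x. u x * exp (- u x)) \<le> ?a * expectation (\<lambda>x. exp (- u x))" .
qed

section \<open>The forward and the backward step\<close>
lemma gaussian_kernel: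
  assumes eta: "0 < \<eta>"
  shows "proximal_kernel (\<lambda>_::'a::euclidean_space. 0) \<eta>"
    and "proximal_kernel.Z (\<lambda>_. 0) \<eta> = (\<lambda>_::'a. (2 * pi * \<eta>) powr (real DIM('a) / 2))"
    and "gaussian \<eta> = backward_kernel (\<lambda>_::'a. 0) \<eta>"
proof -
  let ?g = "\<lambda>x::'a. exp (- (norm x)\<^sup>2 / (2 * \<eta>))"
  have m: "?g \<in> borel_measurable borel" by measurable
  note shift = integral_lborel_shift[OF m]
  show K: "proximal_kernel (\<lambda>_::'a. 0) \<eta>"
    by unfold_locales (use eta shift(1) integrable_exp_neg_norm_sq(1)[OF eta] in auto)
  interpret K: proximal_kernel "\<lambda>_::'a. 0" \<eta> by (rule K)
  show Z: "K.Z = (\<lambda>_. (2 * pi * \<eta>) powr (real DIM('a) / 2))"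
    using shift(2) integrable_exp_neg_norm_sq(2)[OF eta, where 'a='a] by (auto simp: K.Z_def)
  show "gaussian \<eta> = backward_kernel (\<lambda>_::'a. 0) \<eta>"
    by (rule ext) (simp add: K.backward_kernel_eq gaussian_def K.k_def Z powr_minus_divide)
qed

lemma gaussian_step:
  fixes \<rho> :: "'a::euclidean_space measure"
  assumes eta: "0 < \<eta>" and \<rho>: "\<rho> \<in> P2"
  shows "\<rho> \<bind> gaussian \<eta> \<in> P2" "neg_entropy (\<rho> \<bind> gaussian \<eta>) < \<infinity>"
proof -
  interpret K: proximal_kernel "\<lambda>_::'a. 0" \<eta> by (rule gaussian_kernel[OF eta])
  have Z: "K.Z y = K.Z 0" for y unfolding gaussian_kernel(2)[OF eta] by simp
  let ?g = "\<lambda>x::'a. exp (- (norm x)\<^sup>2 / (2 * (2 * \<eta>)))"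
  have m: "?g \<in> borel_measurable borel" by measurable
  have i: "integrable lborel ?g" using integrable_exp_neg_norm_sq(1)[of "2 * \<eta>"] eta by simp
  have "\<rho> \<bind> backward_kernel (\<lambda>_. 0) \<eta> \<in> P2"
  proof (rule K.bind_backward_kernel_in_P2[OF \<rho>])
    fix y :: 'a
    have "(\<integral>\<^sup>+ x. ennreal (K.k y x * (norm (x - y))\<^sup>2) \<partial>lborel)
        \<le> (\<integral>\<^sup>+ x. ennreal (4 * \<eta> / K.Z 0 * ?g (x - y)) \<partial>lborel)"
    proof (intro nn_integral_mono ennreal_leI)
      fix x
      define u where "u = (norm (x - y))\<^sup>2 / (2 * \<eta>)"
      \<comment> \<open>Half of the Gaussian decay absorbs the factor \<open>u\<close>, which leaves a Gaussian of variance
        \<open>2 \<eta>\<close>.\<close>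
      have "u / 2 \<le> exp (u / 2)" using exp_ge_add_one_self[of "u / 2"] by linarith
      then have "u * exp (- u) \<le> 2 * exp (u / 2) * exp (- u)" by (intro mult_right_mono) auto
      also have "\<dots> = 2 * exp (- u / 2)" by (simp add: exp_add[symmetric])
      finally have "2 * \<eta> / K.Z 0 * (u * exp (- u)) \<le> 2 * \<eta> / K.Z 0 * (2 * exp (- u / 2))"
        using eta K.Z_pos[of 0] by (intro mult_left_mono) auto
      moreover have "K.k y x * (norm (x - y))\<^sup>2 = 2 * \<eta> / K.Z 0 * (u * exp (- u))"
        using eta by (simp add: K.k_def Z[of y] u_def)
      ultimately show "K.k y x * (norm (x - y))\<^sup>2 \<le> 4 * \<eta> / K.Z 0 * ?g (x - y)"
        by (simp add: u_def)
    qed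
    also have "\<dots> = ennreal (4 * \<eta> / K.Z 0 * (\<integral>x. ?g x \<partial>lborel))"
      using i integral_lborel_shift[OF m, of y] eta K.Z_pos[of 0]
      by (subst nn_integral_eq_integral) auto
    finally show "(\<integral>\<^sup>+ x. ennreal (K.k y x * (norm (x - y))\<^sup>2) \<partial>lborel)
        \<le> ennreal (4 * \<eta> / K.Z 0 * (\<integral>x. ?g x \<partial>lborel) + 0 * (norm y)\<^sup>2)" by simp
  qed (use eta K.Z_pos[of 0] in \<open>auto intro!: mult_nonneg_nonneg integral_nonneg_AE\<close>)
  then show "\<rho> \<bind> gaussian \<eta> \<in> P2" by (simp add: gaussian_kernel(3)[OF eta])
  have "K.k y x \<le> 1 / K.Z 0" for y x
    using eta K.Z_pos[of 0] by (auto simp: K.k_def Z[of y] intro!: divide_right_mono)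
  then show "neg_entropy (\<rho> \<bind> gaussian \<eta>) < \<infinity>"
    unfolding gaussian_kernel(3)[OF eta]
    by (rule K.neg_entropy_bind_backward_kernel_finite[OF P2D(1,2)[OF \<rho>]])
qed

text \<open>Tilting the target \<open>\<pi>\<close> by \<open>exp (- |x - y|\<^sup>2 / (2\<eta>))\<close> can only decrease the mean of
  \<open>|x - y|\<^sup>2\<close> (Chebyshev), so the kernel has second moments that grow at most quadratically in \<open>y\<close>.
  Jensen bounds the normalising constant below by a Gaussian in \<open>y\<close>, and it is at most the
  constant of \<open>\<pi>\<close>.\<close>
lemma gibbs_step:
  fixes f :: "'a::euclidean_space \<Rightarrow> real"
  assumes eta: "0 < \<eta>" and [measurable]: "f \<in> borel_measurable borel"
    and int: "integrable lborel (\<lambda>x. exp (- f x))" and \<pi>: "gibbs f \<in> P2" and \<rho>: "\<rho> \<in> P2"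
  shows "proximal_kernel f \<eta>" "\<rho> \<bind> backward_kernel f \<eta> \<in> P2"
    "integrable \<rho> (\<lambda>y. ln (proximal_kernel.Z f \<eta> y))"
proof -
  show K: "proximal_kernel f \<eta>"
  proof
    show "integrable lborel (\<lambda>x. exp (- (f x + (norm (x - y))\<^sup>2 / (2 * \<eta>))))" for y
      by (rule Bochner_Integration.integrable_bound[OF int]) (use eta in auto)
  qed (use eta in auto)
  interpret K: proximal_kernel f \<eta> by (rule K)
  note p\<pi> = P2D[OF \<pi>]
  note [measurable_cong] = p\<pi>(2) P2D(2)[OF \<rho>]
  interpret \<pi>: prob_space "gibbs f" by (rule p\<pi>)
  interpret \<rho>: prob_space \<rho> by (rule P2D(1)[OF \<rho>])
  define c where "c = (\<integral>x. exp (- f x) \<partial>lborel)"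
  have gibbs: "gibbs f = density lborel (\<lambda>x. ennreal (exp (- f x) / c))" by (simp add: gibbs_def c_def)
  have "c \<noteq> 0"
    using \<pi>.emeasure_space_1 unfolding gibbs by (auto simp: emeasure_density)
  moreover have "0 \<le> c" unfolding c_def by (intro integral_nonneg_AE) auto
  ultimately have c: "0 < c" by simp
  define M where "M = (\<integral>x. (norm x)\<^sup>2 \<partial>gibbs f)"
  have M: "0 \<le> M" unfolding M_def by (intro integral_nonneg_AE) auto
  define u where "u y x = (norm (x - y))\<^sup>2 / (2 * \<eta>)" for y x :: 'a
  have u0: "0 \<le> u y x" for x y using eta by (simp add: u_def)
  have um [measurable]: "u y \<in> borel_measurable borel" for y unfolding u_def by measurable
  have u_le: "u y x \<le> ((norm x)\<^sup>2 + (norm y)\<^sup>2) / \<eta>" for x y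
    using norm_diff_sq_le[of x y] eta by (simp add: u_def field_simps)
  have i2: "integrable (gibbs f) (\<lambda>x. ((norm x)\<^sup>2 + (norm y)\<^sup>2) / \<eta>)" for y :: 'a
    using p\<pi>(5) by simp
  have iu: "integrable (gibbs f) (u y)" for y
    by (rule Bochner_Integration.integrable_bound[OF i2[of y]])
      (use u0 u_le eta in auto)
  have Eu: "(\<integral>x. u y x \<partial>gibbs f) \<le> (M + (norm y)\<^sup>2) / \<eta>" for y
  proof -
    have "(\<integral>x. u y x \<partial>gibbs f) \<le> (\<integral>x. ((norm x)\<^sup>2 + (norm y)\<^sup>2) / \<eta> \<partial>gibbs f)"
      by (rule integral_mono[OF iu i2 u_le])
    also have "\<dots> = (M + (norm y)\<^sup>2) / \<eta>"
      using p\<pi>(5) by (simp add: M_def \<pi>.prob_space)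
    finally show ?thesis .
  qed
  have lb: "(\<integral>x. g x \<partial>gibbs f) = (\<integral>x. exp (- f x) * g x \<partial>lborel) / c"
    if [measurable]: "g \<in> borel_measurable borel" for g :: "'a \<Rightarrow> real"
    unfolding gibbs using c by (subst integral_density) auto
  have Z: "K.Z y = c * (\<integral>x. exp (- u y x) \<partial>gibbs f)" for y
    using c by (simp add: lb K.Z_def u_def exp_add[symmetric])
  have Z_ge: "c * exp (- ((M + (norm y)\<^sup>2) / \<eta>)) \<le> K.Z y" for y
  proof -
    have "exp (- ((M + (norm y)\<^sup>2) / \<eta>)) \<le> exp (- (\<integral>x. u y x \<partial>gibbs f))" using Eu[of y] by simp
    also have "\<dots> \<le> (\<integral>x. exp (- u y x) \<partial>gibbs f)" by (rule \<pi>.exp_neg_expectation_le(2)[OF iu u0])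
    finally show ?thesis unfolding Z using c by (intro mult_left_mono) auto
  qed
  have Z_le: "K.Z y \<le> c" for y
  proof -
    have "(\<integral>x. exp (- u y x) \<partial>gibbs f) \<le> (\<integral>x. 1 \<partial>gibbs f)"
      by (intro integral_mono \<pi>.exp_neg_expectation_le(1)[OF iu u0]) (use u0 in auto)
    then show ?thesis unfolding Z using c by (simp add: \<pi>.prob_space mult_left_le)
  qed
  show "integrable \<rho> (\<lambda>y. ln (K.Z y))"
  proof (rule Bochner_Integration.integrable_bound)
    show "integrable \<rho> (\<lambda>y. \<bar>ln c\<bar> + (M + (norm y)\<^sup>2) / \<eta>)" using P2D(5)[OF \<rho>] by simp
    show "AE y in \<rho>. norm (ln (K.Z y)) \<le> norm (\<bar>ln c\<bar> + (M + (norm y)\<^sup>2) / \<eta>)"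
    proof (rule AE_I2)
      fix y
      have "ln (c * exp (- ((M + (norm y)\<^sup>2) / \<eta>))) \<le> ln (K.Z y)"
        using Z_ge[of y] c by (intro ln_mono) auto
      then have "ln c - (M + (norm y)\<^sup>2) / \<eta> \<le> ln (K.Z y)" using c by (simp add: ln_mult)
      moreover have "ln (K.Z y) \<le> ln c" using Z_le[of y] K.Z_pos[of y] by simp
      moreover have "0 \<le> (M + (norm y)\<^sup>2) / \<eta>" using M eta by simp
      ultimately show "norm (ln (K.Z y)) \<le> norm (\<bar>ln c\<bar> + (M + (norm y)\<^sup>2) / \<eta>)"
        by (simp add: abs_if)
    qed
  qed measurable
  show "\<rho> \<bind> backward_kernel f \<eta> \<in> P2"
  proof (rule K.bind_backward_kernel_in_P2[OF \<rho>])
    fix y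
    let ?e = "\<lambda>x. u y x * exp (- u y x)"
    have ie: "integrable (gibbs f) ?e" by (rule \<pi>.expectation_mult_exp_neg_le(1)[OF iu u0])
    have k: "ennreal (K.k y x * (norm (x - y))\<^sup>2) = ennreal (exp (- f x) / c) * ennreal (2 * \<eta> * c / K.Z y * ?e x)" for x
      using c eta K.Z_pos[of y]
      by (auto simp: ennreal_mult'[symmetric] K.k_def u_def exp_add[symmetric] exp_minus field_simps exp_add
          intro!: arg_cong[of _ _ ennreal])
    have "(\<integral>\<^sup>+ x. ennreal (K.k y x * (norm (x - y))\<^sup>2) \<partial>lborel) = (\<integral>\<^sup>+ x. ennreal (2 * \<eta> * c / K.Z y * ?e x) \<partial>gibbs f)"
      unfolding k gibbs by (subst nn_integral_density) auto
    also have "\<dots> = ennreal (2 * \<eta> * c / K.Z y * (\<integral>x. ?e x \<partial>gibbs f))"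
      using ie u0 c eta K.Z_pos[of y] by (subst nn_integral_eq_integral) (auto simp: less_imp_le)
    also have "\<dots> \<le> ennreal (2 * M + 2 * (norm y)\<^sup>2)"
    proof (rule ennreal_leI)
      have "(\<integral>x. ?e x \<partial>gibbs f) \<le> (\<integral>x. u y x \<partial>gibbs f) * (\<integral>x. exp (- u y x) \<partial>gibbs f)"
        by (rule \<pi>.expectation_mult_exp_neg_le(2)[OF iu u0])
      also have "\<dots> \<le> (M + (norm y)\<^sup>2) / \<eta> * (K.Z y / c)"
        using Eu[of y] c K.Z_pos[of y] by (intro mult_mono) (use M eta in \<open>auto simp: Z intro!: integral_nonneg_AE\<close>)
      finally have "2 * \<eta> * c / K.Z y * (\<integral>x. ?e x \<partial>gibbs f) \<le> 2 * \<eta> * c / K.Z y * ((M + (norm y)\<^sup>2) / \<eta> * (K.Z y / c))"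
        using c eta K.Z_pos[of y] by (intro mult_left_mono) auto
      also have "\<dots> = 2 * M + 2 * (norm y)\<^sup>2"
        using c eta K.Z_pos[of y] by (simp add: field_simps)
      finally show "2 * \<eta> * c / K.Z y * (\<integral>x. ?e x \<partial>gibbs f) \<le> 2 * M + 2 * (norm y)\<^sup>2" .
    qed
    finally show "(\<integral>\<^sup>+ x. ennreal (K.k y x * (norm (x - y))\<^sup>2) \<partial>lborel) \<le> ennreal (2 * M + 2 * (norm y)\<^sup>2)" .
  qed (use M in auto)
qed

theorem theorem10:
  fixes f :: "'a::euclidean_space \<Rightarrow> real"
    and \<eta> :: real
    and \<rho>X \<rho>Y \<rho>X' :: "'a measure"
  assumes "\<eta> > 0"
    and "f \<in> borel_measurable borel"
    and "integrable lborel (\<lambda>x. exp (- f x))"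
    and "gibbs f \<in> P2"
    and "\<rho>X \<in> P2"
    and "\<rho>Y = \<rho>X \<bind> gaussian \<eta>"
    and "\<rho>X' = \<rho>Y \<bind> backward_kernel f \<eta>"
  shows "\<rho>Y \<in> argmin_on P2 (\<lambda>\<mu>. ereal (1 / (2 * \<eta>)) * entropic_W2_sq (2 * \<eta>) \<rho>X \<mu>)
    \<and> (neg_entropy \<rho>X < \<infinity> \<longrightarrow>
         argmin_on P2 (\<lambda>\<mu>. ereal (1 / (2 * \<eta>)) * entropic_W2_sq (2 * \<eta>) \<rho>X \<mu>) = {\<rho>Y})
    \<and> ((\<integral>\<^sup>+ x. ennreal (- f x) \<partial>\<rho>X') < \<infinity> \<longrightarrow>
         argmin_on P2 (\<lambda>\<mu>. ereal_integral \<mu> f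
           + ereal (1 / (2 * \<eta>)) * entropic_W2_sq (2 * \<eta>) \<rho>Y \<mu>) = {\<rho>X'})"
proof -
  let ?W = "\<lambda>\<mu>. ereal (1 / (2 * \<eta>)) * entropic_W2_sq (2 * \<eta>) \<rho>X \<mu>"
  interpret G: proximal_kernel "\<lambda>_::'a. 0" \<eta> by (rule gaussian_kernel[OF assms(1)])
  interpret X: prob_space \<rho>X by (rule P2D(1)[OF assms(5)])
  have Y: "\<rho>Y \<in> P2" "neg_entropy \<rho>Y < \<infinity>"
    using gaussian_step[OF assms(1,5)] by (simp_all add: assms(6))
  have Y_eq: "\<rho>Y = \<rho>X \<bind> backward_kernel (\<lambda>_. 0) \<eta>"
    by (simp add: assms(6) gaussian_kernel(3)[OF assms(1)])
  have iG: "integrable \<rho>X (\<lambda>y. ln (G.Z y))" by (simp add: gaussian_kernel(2)[OF assms(1)])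
  have forward: "argmin_on P2 ?W = {\<rho>Y}" if "neg_entropy \<rho>X < \<infinity>"
    using G.proximal_step_argmin[OF assms(5) that iG] Y(1)
    by (simp add: Y_eq[symmetric] ereal_integral_eq_integral zero_ereal_def[symmetric])
  moreover have "\<rho>Y \<in> argmin_on P2 ?W"
  proof (cases "neg_entropy \<rho>X < \<infinity>")
    case True
    then show ?thesis by (simp add: forward)
  next
    case False
    \<comment> \<open>The objective is \<open>\<infinity>\<close> on all of \<open>P2\<close>, so every element is a minimiser.\<close>
    have inf: "entropic_W2_sq (2 * \<eta>) \<rho>X \<mu> = \<infinity>" if "\<mu> \<in> P2" for \<mu>
    proof -
      have "neg_entropy \<gamma> = \<infinity>" if "\<gamma> \<in> couplings \<rho>X \<mu>" for \<gamma>
        using G.neg_entropy_fst_finite[OF that _ assms(5) \<open>\<mu> \<in> P2\<close> _ iG] False by auto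
      then have "\<infinity> \<le> entropic_W2_sq (2 * \<eta>) \<rho>X \<mu>"
        unfolding entropic_W2_sq_def using assms(1) by (intro INF_greatest) simp
      then show ?thesis by simp
    qed
    show ?thesis using Y(1) by (auto simp: argmin_on_def is_arg_min_def inf)
  qed
  moreover have "argmin_on P2 (\<lambda>\<mu>. ereal_integral \<mu> f
           + ereal (1 / (2 * \<eta>)) * entropic_W2_sq (2 * \<eta>) \<rho>Y \<mu>) = {\<rho>X'}"
    if "(\<integral>\<^sup>+ x. ennreal (- f x) \<partial>\<rho>X') < \<infinity>"
  proof -
    note step = gibbs_step[OF assms(1-4) Y(1)]
    show ?thesis
      using proximal_kernel.proximal_step_argmin[OF step(1) Y step(3,2)] that
      by (simp add: assms(7)[symmetric])
  qed
  ultimately show ?thesis by blast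
qed

end
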